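(* Let $f(z,\bar z)$ and $g(z,\bar z)$ be complex polynomials in $z$ and $\bar z$ with no common zeros in $\mathbb{C}$, with $\deg f\ge \deg g$. Let $d=\deg f$ and let $T(z,\bar z)$ be the homogeneous polynomial of degree $d$ consisting of the terms of $f$ of degree $d$. Assume that $T(z,\bar z)$ has a (finite or infinite) limit as $|z|\to\infty$, and that $R=\frac{f}{g}$ defines a continuous map $R:\bar{\mathbb{C}}\to\bar{\mathbb{C}}$ (with $R(z)=\infty$ where $g(z)=0$ and $R(\infty)=\lim_{|z|\to\infty} f(z)/g(z)$). Then the degree of $R$ equals $N-d$, where $N$ is the number of roots, counted with multiplicity, of the polynomial $\tilde T(z)=z^d\,T(z,z^{-1})$ of modulus less than $1$. Equivalently, the degree of $R$ equals the winding number about $0$ of the curve $[0,2\pi]\to\mathbb{C}\setminus\{0\}$, $\alpha\mapsto T(e^{i\alpha},e^{-i\alpha})$.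
   Context: $\bar{\mathbb{C}}=\mathbb{C}\cup\{\infty\}$ is the Riemann sphere, identified with $S^2$. The degree of a polynomial in $z,\bar z$ is its total degree (a monomial $z^a\bar z^b$ has degree $a+b$). $T(z,z^{-1})$ means substituting $z^{-1}$ for $\bar z$ in $T$; since $T$ is homogeneous of degree $d$, $\tilde T(z)=z^dT(z,z^{-1})$ is an ordinary polynomial in $z$. The degree of a continuous map $S^2\to S^2$ is the integer corresponding to its homotopy class under $\pi_2(S^2)\cong\mathbb{Z}$ with the identity having degree $1$. The winding number of a closed curve in $\mathbb{C}\setminus\{0\}$ is its class in $\pi_1(\mathbb{C}\setminus\{0\})\cong\mathbb{Z}$, with counterclockwise loops positive. *)

theory Defs
  imports "HOL-Homology.Homology" "HOL-Complex_Analysis.Complex_Analysis"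
begin

text \<open>A complex polynomial in z and conj z is given by its coefficient function
  c a b (coefficient of z^a * conj z^b) with finite support.\<close>

definition zzpoly :: "(nat \<Rightarrow> nat \<Rightarrow> complex) \<Rightarrow> bool" where
  "zzpoly c \<longleftrightarrow> finite {(a, b). c a b \<noteq> 0}"

definition zzeval :: "(nat \<Rightarrow> nat \<Rightarrow> complex) \<Rightarrow> complex \<Rightarrow> complex" where
  "zzeval c z = (\<Sum>(a, b) \<in> {(a, b). c a b \<noteq> 0}. c a b * z ^ a * cnj z ^ b)"

text \<open>Total degree (the zero polynomial gets degree 0 here; it is excluded separately).\<close>
definition zzdeg :: "(nat \<Rightarrow> nat \<Rightarrow> complex) \<Rightarrow> nat" where
  "zzdeg c = Max (insert 0 {a + b | a b. c a b \<noteq> 0})"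

definition zzhom :: "nat \<Rightarrow> (nat \<Rightarrow> nat \<Rightarrow> complex) \<Rightarrow> nat \<Rightarrow> nat \<Rightarrow> complex" where
  "zzhom d c a b = (if a + b = d then c a b else 0)"

text \<open>For T homogeneous of degree d, the ordinary polynomial z^d * T(z, z^-1):
  the monomial z^a conj z^b (a + b = d) becomes z^(d + a - b).\<close>
definition zztilde :: "nat \<Rightarrow> (nat \<Rightarrow> nat \<Rightarrow> complex) \<Rightarrow> complex poly" where
  "zztilde d T = (\<Sum>(a, b) \<in> {(a, b). T a b \<noteq> 0}. monom (T a b) (d + a - b))"

text \<open>Riemann sphere as complex option (None = infinity), identified with the
  unit 2-sphere nsphere 2 via inverse stereographic projection.\<close>
definition stereo :: "complex option \<Rightarrow> nat \<Rightarrow> real" where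
  "stereo w = (case w of
      None \<Rightarrow> (\<lambda>i. if i = 2 then 1 else 0)
    | Some z \<Rightarrow> (\<lambda>i. if i = 0 then 2 * Re z / (norm z ^ 2 + 1)
                    else if i = 1 then 2 * Im z / (norm z ^ 2 + 1)
                    else if i = 2 then (norm z ^ 2 - 1) / (norm z ^ 2 + 1)
                    else 0))"

definition unstereo :: "(nat \<Rightarrow> real) \<Rightarrow> complex option" where
  "unstereo x = (if x 2 = 1 then None
                 else Some (Complex (x 0 / (1 - x 2)) (x 1 / (1 - x 2))))"

definition ratmap :: "(nat \<Rightarrow> nat \<Rightarrow> complex) \<Rightarrow> (nat \<Rightarrow> nat \<Rightarrow> complex) \<Rightarrow> complex option
    \<Rightarrow> complex option \<Rightarrow> complex option" where
  "ratmap f g rho w = (case w of None \<Rightarrow> rho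
     | Some z \<Rightarrow> (if zzeval g z = 0 then None else Some (zzeval f z / zzeval g z)))"

definition sphmap :: "(complex option \<Rightarrow> complex option) \<Rightarrow> (nat \<Rightarrow> real) \<Rightarrow> nat \<Rightarrow> real" where
  "sphmap F x = stereo (F (unstereo x))"

end

theory Submission
  imports Defs "HOL-Computational_Algebra.Fundamental_Theorem_Algebra"
begin

text \<open>Write R = [f : g] in homogeneous coordinates. Since T has no zeros on the unit circle, f is
  nonzero for |z| \<ge> r and |f/g| is bounded below there, so R(\<infinity>) \<noteq> 0 and g can be deformed to a
  function vanishing for |z| \<ge> r without changing the degree. For such pairs the degree depends only
  on the winding number of f on the circle of radius r: a homotopy of the boundary loops in the
  punctured plane extends over the 3-dimensional cylinder as a map into the 3-sphere, because maps from
  closed subsets of a 3-dimensional polytope into the 3-sphere always extend. For model pairs the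
  degree is computed by adding degrees over two hemispheres, starting from the identity (winding number
  1) and a reflection (winding number -1). Finally f and T have the same winding number on a large
  circle, and the one of T is N - d by counting the roots of z^d T(z, 1/z).\<close>

subsection \<open>Additivity of the degree over hemispheres\<close>

text \<open>The obstacle is the point at infinity: \<open>R\<close> is merely continuous there, and
  the pair of polynomials says nothing at that point itself. Cutting the second coordinate off makes
  the map constantly infinity near this point, and the rest happens on a disc. The cutoff multiplies
  g by a factor that reaches 0, which is harmless only where f has no zero; at infinity, where f has
  no value, the substitute is R(\<infinity>) \<noteq> 0.

  Pairs are preferred to quotients because a pair without common zeros is a map into C^2 minus the
  origin, which retracts onto the 3-sphere. On the boundary circle, where the second coordinate is
  0, the pair reduces to a loop in the punctured plane, and this loop carries all the information.
  The freedom to replace a pair by any other with the same winding number allows models whose zeros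
  lie in opposite half-planes, so that additivity over hemispheres applies.\<close>

lemma hom_induced_into_singleton:
  assumes f: "continuous_map X Y f" and c: "\<And>x. x \<in> topspace X \<Longrightarrow> f x = c"
  shows "hom_induced p X S Y {c} f u = \<one>\<^bsub>relative_homology_group p Y {c}\<^esub>"
proof (cases "c \<in> topspace Y")
  case True
  let ?C = "subtopology Y {c}"
  let ?f = "\<lambda>x. c"
  have "continuous_map X ?C ?f"
    using True by simp
  \<comment> \<open>The map factors through the pair ({c}, {c}), whose relative homology is
    trivial.\<close>
  then have eq: "hom_induced p X S Y {c} (id \<circ> ?f) u = hom_induced p ?C {c} Y {c} id (hom_induced p X S ?C {c} ?f u)"
    by (subst hom_induced_compose [where T = "{c}"]) (auto simp: continuous_map_from_subtopology)
  have "topspace ?C = {c}" using True by auto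
  then have "trivial_group (relative_homology_group p ?C {c})"
    by (metis trivial_relative_homology_group_topspace)
  then have "hom_induced p X S ?C {c} ?f u = \<one>\<^bsub>relative_homology_group p ?C {c}\<^esub>"
    using hom_induced_carrier by (fastforce simp: trivial_group_def)
  moreover have "hom_induced p X S Y {c} f = hom_induced p X S Y {c} (id \<circ> ?f)"
    by (rule hom_induced_eq) (simp add: c)
  ultimately show ?thesis
    using eq by (metis group_relative_homology_group hom_induced_hom hom_one)
next
  case False
  then have emp: "topspace X = {}"
    using f c by (metis continuous_map_image_subset_topspace image_subset_iff ex_in_conv)
  have "trivial_group (relative_homology_group p X S)"
    by (simp add: emp trivial_relative_homology_group_empty)
  then show ?thesis
    by (metis (no_types, lifting) emp empty_iff group_relative_homology_group hom_induced_default hom_induced_hom hom_one singletonD trivial_group_def)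
qed

text \<open>By excision the upper hemisphere relative to the equator has the homology of the sphere
  relative to the lower hemisphere. This provides \<open>u\<close>; the difference of
  \<open>y\<close> and the image of \<open>u\<close> dies relative to the lower hemisphere, so by
  exactness of the triple it comes from some \<open>l\<close>.\<close>

lemma relative_nsphere_split:
  assumes y: "y \<in> carrier (relative_homology_group p (nsphere n) {x. x k = 0})"
  obtains u l where
    "u \<in> carrier (relative_homology_group p (subtopology (nsphere n) {x. x k \<ge> 0}) {x. x k = 0})"
    "l \<in> carrier (relative_homology_group p (subtopology (nsphere n) {x. x k \<le> 0}) {x. x k = 0})"
    "y = hom_induced p (subtopology (nsphere n) {x. x k \<ge> 0}) {x. x k = 0} (nsphere n) {x. x k = 0} id u
       \<otimes>\<^bsub>relative_homology_group p (nsphere n) {x. x k = 0}\<^esub>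
         hom_induced p (subtopology (nsphere n) {x. x k \<le> 0}) {x. x k = 0} (nsphere n) {x. x k = 0} id l"
proof -
  let ?X = "nsphere n"
  let ?U = "{x. x k \<ge> (0::real)}" and ?L = "{x. x k \<le> (0::real)}" and ?E = "{x. x k = (0::real)}"
  let ?G = "relative_homology_group p ?X ?E"
  let ?q = "hom_induced p ?X ?E ?X ?L id"
  let ?iU = "hom_induced p (subtopology ?X ?U) ?E ?X ?E id"
  let ?iL = "hom_induced p (subtopology ?X ?L) ?E ?X ?E id"
  interpret G: comm_group ?G by simp
  interpret q: group_hom ?G "relative_homology_group p ?X ?L" ?q
    by (simp add: group_hom_def group_hom_axioms_def hom_induced_hom)
  have "?q y \<in> carrier (relative_homology_group p ?X ?L)"
    using y by simp
  also have "\<dots> = hom_induced p (subtopology ?X ?U) ?E ?X ?L id `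
                     carrier (relative_homology_group p (subtopology ?X ?U) ?E)"
    using iso_relative_homology_group_upper_hemisphere [of p n k]
    by (simp only: Group.iso_iff)
  finally obtain u where u: "u \<in> carrier (relative_homology_group p (subtopology ?X ?U) ?E)"
    and qu: "?q y = hom_induced p (subtopology ?X ?U) ?E ?X ?L id u"
    by (rule imageE)
  have iu: "?iU u \<in> carrier ?G"
    by (simp add: hom_induced_carrier)
  have "?q (?iU u) = ?q y"
    unfolding qu
    by (subst hom_induced_compose') (auto simp: continuous_map_from_subtopology)
  then have "?q (y \<otimes>\<^bsub>?G\<^esub> inv\<^bsub>?G\<^esub> ?iU u) = \<one>\<^bsub>relative_homology_group p ?X ?L\<^esub>"
    using y iu by (metis G.inv_closed q.hom_closed q.hom_inv q.hom_mult q.H.r_inv)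
  then have "y \<otimes>\<^bsub>?G\<^esub> inv\<^bsub>?G\<^esub> ?iU u \<in> kernel ?G (relative_homology_group p ?X ?L) ?q"
    using y iu by (simp add: kernel_def)
  moreover have "?E \<subseteq> ?L" by auto
  ultimately have "y \<otimes>\<^bsub>?G\<^esub> inv\<^bsub>?G\<^esub> ?iU u \<in> ?iL ` carrier (relative_homology_group p (subtopology ?X ?L) ?E)"
    using homology_exactness_triple_3 [of ?E ?L p ?X] by simp
  then obtain l where l: "l \<in> carrier (relative_homology_group p (subtopology ?X ?L) ?E)"
     and "y \<otimes>\<^bsub>?G\<^esub> inv\<^bsub>?G\<^esub> ?iU u = ?iL l" by blast
  then have "y = ?iU u \<otimes>\<^bsub>?G\<^esub> ?iL l"
    using y iu by (metis G.inv_closed G.m_comm G.inv_solve_right hom_induced_carrier)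
  then show thesis using that u l by blast
qed

text \<open>All three maps send the equator to \<open>c\<close>, so they act on homology relative to
  the equator, where a class splits into an upper and a lower part. On each part one of
  \<open>h1\<close>, \<open>h2\<close> agrees with \<open>h\<close> and the other is constant,
  contributing nothing.\<close>

proposition Brouwer_degree2_add:
  assumes h: "continuous_map (nsphere n) (nsphere n) h"
    and h1: "continuous_map (nsphere n) (nsphere n) h1"
    and h2: "continuous_map (nsphere n) (nsphere n) h2"
    and upper: "\<And>x. \<lbrakk>x \<in> topspace (nsphere n); x k \<ge> 0\<rbrakk> \<Longrightarrow> h1 x = h x \<and> h2 x = c"
    and lower: "\<And>x. \<lbrakk>x \<in> topspace (nsphere n); x k \<le> 0\<rbrakk> \<Longrightarrow> h1 x = c \<and> h2 x = h x"
  shows "Brouwer_degree2 n h = Brouwer_degree2 n h1 + Brouwer_degree2 n h2"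
proof (rule Brouwer_degree2_unique [OF h])
  let ?X = "nsphere n"
  let ?U = "{x. x k \<ge> (0::real)}" and ?L = "{x. x k \<le> (0::real)}"
  \<comment> \<open>Only points of the sphere are kept: \<open>upper\<close> and
    \<open>lower\<close> say nothing about the maps elsewhere, while a map of pairs must send all of
    \<open>E\<close> into \<open>{c}\<close>.\<close>
  define E where "E = topspace ?X \<inter> {x. x k = (0::real)}"
  have GE: "relative_homology_group n ?X {x. x k = 0} = relative_homology_group n ?X E"
    by (simp add: E_def)
  let ?G = "relative_homology_group n ?X E" and ?K = "relative_homology_group n ?X {c}"
  let ?R = "reduced_homology_group n ?X" and ?H = "homology_group n ?X"
  let ?j = "hom_induced n ?X {} ?X E id" and ?jc = "hom_induced n ?X {} ?X {c} id"
  fix x assume x: "x \<in> carrier ?R"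
  \<comment> \<open>Any point of the upper hemisphere would do: \<open>h2\<close> maps it to
    \<open>c\<close>, so \<open>c\<close> lies on the sphere.\<close>
  obtain e where e: "e \<in> topspace ?X" "e k \<ge> 0"
    by (rule that [OF in_topspace_nsphere]) simp
  have c: "c \<in> topspace ?X"
    using upper [OF e] continuous_map_image_subset_topspace [OF h2] e(1) by auto
  interpret G: comm_group ?G by simp
  interpret K: comm_group ?K by simp
  interpret R: group ?R by simp
  have iso: "?jc \<in> iso ?R ?K"
    using c by (intro iso_reduced_homology_by_contractible contractible_space_subtopology_singleton) blast+
  interpret jc: group_hom ?R ?K ?jc
    by unfold_locales (rule iso_imp_homomorphism [OF iso])
  \<comment> \<open>The sum formula is proved relative to \<open>{c}\<close> and pulled back to
    reduced homology by this injectivity.\<close>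
  have inj: "inj_on ?jc (carrier ?R)"
    using iso by (simp only: Group.iso_iff)
  have "?j x \<in> carrier (relative_homology_group n ?X {x. x k = 0})"
    unfolding GE by (rule hom_induced_carrier)
  then obtain u l where
    u: "u \<in> carrier (relative_homology_group n (subtopology ?X ?U) {x. x k = 0})" and
    l: "l \<in> carrier (relative_homology_group n (subtopology ?X ?L) {x. x k = 0})" and
    jx: "?j x = hom_induced n (subtopology ?X ?U) {x. x k = 0} ?X {x. x k = 0} id u \<otimes>\<^bsub>?G\<^esub>
         hom_induced n (subtopology ?X ?L) {x. x k = 0} ?X {x. x k = 0} id l"
    by (rule relative_nsphere_split) (simp only: GE)
  let ?hU = "\<lambda>h. hom_induced n (subtopology ?X ?U) E ?X {c} h u"
  let ?hL = "\<lambda>h. hom_induced n (subtopology ?X ?L) E ?X {c} h l"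
  have restrict: "hom_induced n (subtopology ?X V) {x. x k = 0} ?X {x. x k = 0} id =
      hom_induced n (subtopology ?X V) E ?X E id" for V
  proof -
    have E: "topspace ?X \<inter> E = topspace ?X \<inter> {x. x k = 0}"
            "topspace (subtopology ?X V) \<inter> E = topspace (subtopology ?X V) \<inter> {x. x k = 0}"
      by (auto simp: E_def)
    show ?thesis
      using hom_induced_restrict [of n "subtopology ?X V" E ?X E]
            hom_induced_restrict [of n "subtopology ?X V" "{x. x k = 0}" ?X "{x. x k = 0}"]
      unfolding E by (simp only:)
  qed
  have jx': "?j x = hom_induced n (subtopology ?X ?U) E ?X E id u \<otimes>\<^bsub>?G\<^esub>
         hom_induced n (subtopology ?X ?L) E ?X E id l"
    using jx unfolding restrict .
  have split: "?jc (hom_induced n ?X {} ?X {} f x) = ?hU f \<otimes>\<^bsub>?K\<^esub> ?hL f"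
    if f: "continuous_map ?X ?X f" and fc: "f \<in> E \<rightarrow> {c}" for f
  proof -
    interpret f: group_hom ?G ?K "hom_induced n ?X E ?X {c} f"
      by (simp add: group_hom_def group_hom_axioms_def hom_induced_hom)
    have "?jc (hom_induced n ?X {} ?X {} f x) = hom_induced n ?X {} ?X {c} (id \<circ> f) x"
      using f by (subst hom_induced_compose') auto
    also have "\<dots> = hom_induced n ?X E ?X {c} f (?j x)"
      using f fc by (subst hom_induced_compose') auto
    also have "\<dots> = hom_induced n ?X E ?X {c} f (hom_induced n (subtopology ?X ?U) E ?X E id u)
        \<otimes>\<^bsub>?K\<^esub> hom_induced n ?X E ?X {c} f (hom_induced n (subtopology ?X ?L) E ?X E id l)"
      unfolding jx' by (simp add: hom_induced_carrier)
    also have "\<dots> = ?hU f \<otimes>\<^bsub>?K\<^esub> ?hL f"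
      using f fc
      by (simp add: hom_induced_compose' continuous_map_from_subtopology)
    finally show ?thesis .
  qed
  have "h x = c \<and> h1 x = c \<and> h2 x = c" if "x \<in> E" for x
  proof -
    have "x \<in> topspace ?X" "x k = 0" using that by (simp_all add: E_def)
    then show ?thesis using upper lower by (metis order_refl)
  qed
  then have E: "h \<in> E \<rightarrow> {c}" "h1 \<in> E \<rightarrow> {c}" "h2 \<in> E \<rightarrow> {c}"
    by auto
  have same: "?hU h1 = ?hU h" "?hL h2 = ?hL h"
    using upper lower by (auto intro!: hom_induced_eq [THEN fun_cong])
  have one: "?hU h2 = \<one>\<^bsub>?K\<^esub>"
    by (rule hom_induced_into_singleton) (use upper h2 in \<open>auto intro: continuous_map_from_subtopology\<close>)
  have one': "?hL h1 = \<one>\<^bsub>?K\<^esub>"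
    by (rule hom_induced_into_singleton) (use lower h1 in \<open>auto intro: continuous_map_from_subtopology\<close>)
  have "?jc (hom_induced n ?X {} ?X {} h x)
     = ?jc (hom_induced n ?X {} ?X {} h1 x) \<otimes>\<^bsub>?K\<^esub> ?jc (hom_induced n ?X {} ?X {} h2 x)"
    unfolding split [OF h E(1)] split [OF h1 E(2)] split [OF h2 E(3)] one one' same
    by (simp only: K.r_one K.l_one hom_induced_carrier)
  also have "\<dots> = ?jc (hom_induced n ?X {} ?X {} h1 x \<otimes>\<^bsub>?R\<^esub> hom_induced n ?X {} ?X {} h2 x)"
    using x by (simp add: hom_induced_reduced)
  finally have "hom_induced n ?X {} ?X {} h x = hom_induced n ?X {} ?X {} h1 x \<otimes>\<^bsub>?R\<^esub> hom_induced n ?X {} ?X {} h2 x"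
    by (rule inj_onD [OF inj]) (use x in \<open>simp_all add: hom_induced_reduced\<close>)
  then show "hom_induced n ?X {} ?X {} h x = x [^]\<^bsub>?R\<^esub> (Brouwer_degree2 n h1 + Brouwer_degree2 n h2)"
    using x by (simp add: Brouwer_degree2 R.int_pow_mult)
qed

subsection \<open>Winding numbers of products\<close>

text \<open>Continuous logarithms of the two paths add up to one of the product. The paths need not
  be closed.\<close>

lemma winding_number_mult:
  assumes p: "path p" "0 \<notin> path_image p" and q: "path q" "0 \<notin> path_image q"
  shows "winding_number (\<lambda>t. p t * q t) 0 = winding_number p 0 + winding_number q 0"
proof -
  obtain u where u: "path u" "pathfinish u - pathstart u = 2 * of_real pi * \<i> * winding_number p 0"
      "\<And>t. t \<in> {0..1} \<Longrightarrow> p t = 0 + exp (u t)"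
    using winding_number_as_continuous_log [OF p] by metis
  obtain v where v: "path v" "pathfinish v - pathstart v = 2 * of_real pi * \<i> * winding_number q 0"
      "\<And>t. t \<in> {0..1} \<Longrightarrow> q t = 0 + exp (v t)"
    using winding_number_as_continuous_log [OF q] by metis
  have "winding_number (\<lambda>t. p t * q t) 0 = winding_number (exp \<circ> (\<lambda>t. u t + v t)) 0"
    by (rule winding_number_cong) (simp add: u v exp_add)
  also have "\<dots> = (pathfinish (\<lambda>t. u t + v t) - pathstart (\<lambda>t. u t + v t)) / (2 * of_real pi * \<i>)"
    using u v by (intro winding_number_compose_exp) (auto simp: path_def intro!: continuous_intros)
  also have "\<dots> = ((pathfinish u - pathstart u) + (pathfinish v - pathstart v)) / (2 * of_real pi * \<i>)"
    by (simp add: pathfinish_def pathstart_def algebra_simps)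
  also have "\<dots> = winding_number p 0 + winding_number q 0"
    unfolding u v by (simp add: field_simps)
  finally show ?thesis .
qed

lemma winding_number_const: "c \<noteq> 0 \<Longrightarrow> winding_number (\<lambda>t. c) 0 = 0"
  using winding_number_zero_const by blast

lemma winding_number_power:
  assumes p: "path p" "0 \<notin> path_image p"
  shows "winding_number (\<lambda>t. p t ^ n) 0 = of_nat n * winding_number p 0"
proof (induction n)
  case 0
  show ?case by (simp add: winding_number_const)
next
  case (Suc n)
  have "path (\<lambda>t. p t ^ n)" "0 \<notin> path_image (\<lambda>t. p t ^ n)"
    using p by (auto simp: path_def path_image_def intro!: continuous_intros)
  then show ?case
    using winding_number_mult [OF p, of "\<lambda>t. p t ^ n"] Suc by (simp add: algebra_simps)
qed

lemma winding_number_cmult: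
  assumes "path p" "0 \<notin> path_image p" "c \<noteq> 0"
  shows "winding_number (\<lambda>t. c * p t) 0 = winding_number p 0"
  using assms winding_number_mult [of "\<lambda>t. c" p]
  by (auto simp: winding_number_const path_def path_image_def)

lemma circlepath_cis: "circlepath z r = (\<lambda>t. z + of_real r * cis (2 * pi * t))"
  by (simp add: circlepath cis_conv_exp mult_ac)

lemma winding_number_shifted_circle:
  assumes "r > 0" "norm a \<noteq> r"
  shows "winding_number (\<lambda>t. of_real r * cis (2 * pi * t) - a) 0 = (if norm a < r then 1 else 0)"
proof -
  have "winding_number (\<lambda>t. of_real r * cis (2 * pi * t) - a) 0 = winding_number (circlepath 0 r) a"
    using winding_number_offset [of "circlepath 0 r" a] by (simp add: circlepath_cis)
  also have "\<dots> = (if norm a < r then 1 else 0)"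
  proof (cases "norm a < r")
    case True
    then show ?thesis by (simp add: winding_number_circlepath)
  next
    case False
    then have "a \<notin> cball 0 r" using assms by simp
    then show ?thesis
      using False assms by (intro winding_number_zero_outside [where s="cball 0 r", THEN trans])
         (auto simp: dist_norm)
  qed
  finally show ?thesis .
qed

text \<open>Each linear factor contributes 1 if its root lies inside the circle and 0 otherwise; the
  multiset of roots accounts for multiplicities.\<close>

lemma winding_number_poly_circle:
  fixes p :: "complex poly"
  assumes "p \<noteq> 0" and "\<And>z. norm z = 1 \<Longrightarrow> poly p z \<noteq> 0"
  shows "winding_number (\<lambda>t. poly p (cis (2 * pi * t))) 0
       = of_nat (\<Sum>z \<in> {z. poly p z = 0 \<and> norm z < 1}. order z p)"
proof -
  have wn: "winding_number (\<lambda>t. \<Prod>a\<in>#A. cis (2 * pi * t) - a) 0 = of_nat (size {#a \<in># A. norm a < 1#})"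
    if "\<And>a. a \<in># A \<Longrightarrow> norm a \<noteq> 1" for A
    using that
  proof (induction A)
    case empty
    show ?case by (simp add: winding_number_const)
  next
    case (add a A)
    have "winding_number (\<lambda>t. \<Prod>b\<in>#add_mset a A. cis (2 * pi * t) - b) 0
        = winding_number (\<lambda>t. cis (2 * pi * t) - a) 0 + winding_number (\<lambda>t. \<Prod>b\<in>#A. cis (2 * pi * t) - b) 0"
      unfolding image_mset_add_mset prod_mset.add_mset
    proof (rule winding_number_mult)
      have "continuous_on {0..1} (\<lambda>t. \<Prod>b\<in>#B. cis (2 * pi * t) - b)" for B
        by (induction B) (auto intro!: continuous_intros)
      then show "path (\<lambda>t. \<Prod>b\<in>#A. cis (2 * pi * t) - b)" by (simp add: path_def)
      show "path (\<lambda>t. cis (2 * pi * t) - a)" by (auto simp: path_def intro!: continuous_intros)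
      show "0 \<notin> path_image (\<lambda>t. cis (2 * pi * t) - a)"
        using add.prems [of a] by (auto simp: path_image_def)
      show "0 \<notin> path_image (\<lambda>t. \<Prod>b\<in>#A. cis (2 * pi * t) - b)"
        using add.prems by (fastforce simp: path_image_def)
    qed
    also have "\<dots> = of_nat (size {#b \<in># add_mset a A. norm b < 1#})"
      using add winding_number_shifted_circle [of 1 a] by simp
    finally show ?case .
  qed
  have poly_eq: "poly p w = lead_coeff p * (\<Prod>a\<in>#proots p. w - a)" for w
  proof -
    have "poly p w = poly (smult (lead_coeff p) (\<Prod>x\<in>#proots p. [:-x, 1:])) w"
      by (simp only: complex_poly_decompose_multiset)
    also have "\<dots> = lead_coeff p * (\<Prod>a\<in>#proots p. w - a)"
      by (simp add: poly_prod_mset image_mset.compositionality o_def)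
    finally show ?thesis .
  qed
  have "winding_number (\<lambda>t. poly p (cis (2 * pi * t))) 0 = winding_number (\<lambda>t. \<Prod>a\<in>#proots p. cis (2 * pi * t) - a) 0"
    unfolding poly_eq
  proof (rule winding_number_cmult)
    have "continuous_on {0..1} (\<lambda>t. \<Prod>b\<in>#B. cis (2 * pi * t) - b)" for B
      by (induction B) (auto intro!: continuous_intros)
    then show "path (\<lambda>t. \<Prod>b\<in>#proots p. cis (2 * pi * t) - b)" by (simp add: path_def)
    show "0 \<notin> path_image (\<lambda>t. \<Prod>a\<in>#proots p. cis (2 * pi * t) - a)"
      using assms by (auto simp: path_image_def)
  qed (use assms in auto)
  also have "\<dots> = of_nat (size {#a \<in># proots p. norm a < 1#})"
    using assms by (intro wn) auto
  also have "size {#a \<in># proots p. norm a < 1#} = (\<Sum>z \<in> {z. poly p z = 0 \<and> norm z < 1}. order z p)"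
    using assms by (simp add: size_multiset_overloaded_eq)
  finally show ?thesis .
qed

subsection \<open>Homogeneous coordinates on the sphere\<close>

text \<open>Makes \<open>continuous_on\<close> and its rules available for maps between
  spheres.\<close>

lemma nsphere_eq_top_of_set: "nsphere n = top_of_set (topspace (nsphere n))"
  by (simp add: nsphere euclidean_product_topology)

lemma continuous_map_nsphere_iff:
  "continuous_map (nsphere m) (nsphere n) f \<longleftrightarrow>
    continuous_on (topspace (nsphere m)) f \<and> f \<in> topspace (nsphere m) \<rightarrow> topspace (nsphere n)"
  using continuous_map_subtopology_eu [of "topspace (nsphere m)" "topspace (nsphere n)" f]
  by (metis continuous_map_iff_continuous continuous_map_in_subtopology nsphere_eq_top_of_set topspace_euclidean_subtopology image_subset_iff_funcset)

lemma homotopic_nsphere_mapsI: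
  assumes "continuous_on ({0..1::real} \<times> topspace (nsphere m)) H"
    and "\<And>t x. \<lbrakk>t \<in> {0..1}; x \<in> topspace (nsphere m)\<rbrakk> \<Longrightarrow> H (t, x) \<in> topspace (nsphere n)"
    and "\<And>x. x \<in> topspace (nsphere m) \<Longrightarrow> H (0, x) = f x"
    and "\<And>x. x \<in> topspace (nsphere m) \<Longrightarrow> H (1, x) = g x"
  shows "homotopic_with (\<lambda>x. True) (nsphere m) (nsphere n) f g"
proof -
  have "prod_topology (top_of_set {0..1}) (nsphere m) = top_of_set ({0..1::real} \<times> topspace (nsphere m))"
    by (metis nsphere_eq_top_of_set prod_topology_subtopology_eu)
  moreover have "continuous_map (top_of_set ({0..1} \<times> topspace (nsphere m))) (top_of_set (topspace (nsphere n))) H"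
    using assms(1,2) by (auto simp: continuous_map_in_subtopology)
  ultimately have "continuous_map (prod_topology (top_of_set {0..1}) (nsphere m)) (nsphere n) H"
    by (metis nsphere_eq_top_of_set)
  then show ?thesis
    using assms(3,4) by (subst homotopic_with) (auto intro!: exI [of _ H])
qed

lemma topspace_nsphere_2:
  "x \<in> topspace (nsphere 2) \<longleftrightarrow> (x 0)\<^sup>2 + (x 1)\<^sup>2 + (x 2)\<^sup>2 = 1 \<and> (\<forall>i>2. x i = 0)"
  by (simp add: nsphere eval_nat_numeral)

definition north_pole :: "nat \<Rightarrow> real" where
  "north_pole = (\<lambda>i. if i = 2 then 1 else 0)"

text \<open>The point u/v of the Riemann sphere, with homogeneous coordinates [u : v], on the unit sphere;
  meaningless for u = v = 0.\<close>
definition hopf :: "complex \<Rightarrow> complex \<Rightarrow> nat \<Rightarrow> real" where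
  "hopf u v = (\<lambda>i. if i = 0 then 2 * Re (u * cnj v) / ((norm u)\<^sup>2 + (norm v)\<^sup>2)
     else if i = 1 then 2 * Im (u * cnj v) / ((norm u)\<^sup>2 + (norm v)\<^sup>2)
     else if i = 2 then ((norm u)\<^sup>2 - (norm v)\<^sup>2) / ((norm u)\<^sup>2 + (norm v)\<^sup>2) else 0)"

definition stereo_coord :: "(nat \<Rightarrow> real) \<Rightarrow> complex" where
  "stereo_coord x = Complex (x 0 / (1 - x 2)) (x 1 / (1 - x 2))"

text \<open>The value infinity at infinity is built in, which suits the maps obtained after the
  cutoff: they equal \<open>north_pole\<close> outside a disc.\<close>

definition extend_infinity :: "(complex \<Rightarrow> nat \<Rightarrow> real) \<Rightarrow> (nat \<Rightarrow> real) \<Rightarrow> nat \<Rightarrow> real" where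
  "extend_infinity h x = (if x 2 = 1 then north_pole else h (stereo_coord x))"

lemma north_pole_in_nsphere [simp]: "north_pole \<in> topspace (nsphere 2)"
  by (simp add: topspace_nsphere_2 north_pole_def)

lemma nsphere_2_north:
  assumes "x \<in> topspace (nsphere 2)" "x 2 = 1"
  shows "x = north_pole"
proof
  fix i :: nat
  have "(x 0)\<^sup>2 + (x 1)\<^sup>2 = 0" "\<forall>i>2. x i = 0" using assms by (auto simp: topspace_nsphere_2)
  moreover have "i = 0 \<or> i = 1 \<or> i = 2 \<or> i > 2" by linarith
  ultimately show "x i = north_pole i"
    using assms(2) by (auto simp: north_pole_def sum_power2_eq_zero_iff)
qed

lemma nsphere_2_bounds:
  assumes "x \<in> topspace (nsphere 2)" shows "-1 \<le> x 2" "x 2 \<le> 1"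
  using topspace_nsphere_1 [OF assms, of 2] by (auto simp: abs_square_le_1 abs_le_iff)

lemma hopf_in_nsphere:
  assumes "u \<noteq> 0 \<or> v \<noteq> 0"
  shows "hopf u v \<in> topspace (nsphere 2)"
proof -
  define N where "N = (norm u)\<^sup>2 + (norm v)\<^sup>2"
  have N: "N \<noteq> 0" using assms by (auto simp: N_def sum_power2_eq_zero_iff)
  have "(Re (u * cnj v))\<^sup>2 + (Im (u * cnj v))\<^sup>2 = (norm u)\<^sup>2 * (norm v)\<^sup>2"
    by (metis cmod_power2 complex_mod_cnj norm_mult power_mult_distrib)
  moreover have "(2 * a)\<^sup>2 + (2 * b)\<^sup>2 + (p - q)\<^sup>2 = (p + q)\<^sup>2" if "a\<^sup>2 + b\<^sup>2 = p * q" for a b p q :: real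
    using that by (simp add: power2_eq_square algebra_simps)
  ultimately have "(2 * Re (u * cnj v))\<^sup>2 + (2 * Im (u * cnj v))\<^sup>2 + ((norm u)\<^sup>2 - (norm v)\<^sup>2)\<^sup>2 = N\<^sup>2"
    unfolding N_def by blast
  then have "(2 * Re (u * cnj v) / N)\<^sup>2 + (2 * Im (u * cnj v) / N)\<^sup>2 + (((norm u)\<^sup>2 - (norm v)\<^sup>2) / N)\<^sup>2 = 1"
    using N by (simp only: power_divide add_divide_distrib [symmetric]) simp
  then show ?thesis
    by (simp add: topspace_nsphere_2 hopf_def N_def)
qed

text \<open>Homogeneous coordinates matter only up to a common nonzero factor. This permits
  normalizing pairs and cancelling factors below.\<close>

lemma hopf_scale:
  assumes "c \<noteq> 0"
  shows "hopf (c * u) (c * v) = hopf u v"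
proof -
  have "c * u * cnj (c * v) = complex_of_real ((norm c)\<^sup>2) * (u * cnj v)"
    by (subst complex_norm_square) (simp add: mult_ac)
  then have "Re (c * u * cnj (c * v)) = (norm c)\<^sup>2 * Re (u * cnj v)"
            "Im (c * u * cnj (c * v)) = (norm c)\<^sup>2 * Im (u * cnj v)"
    by (simp_all only: Re_complex_of_real Im_complex_of_real times_complex.sel)
  moreover have "(norm (c * u))\<^sup>2 + (norm (c * v))\<^sup>2 = (norm c)\<^sup>2 * ((norm u)\<^sup>2 + (norm v)\<^sup>2)"
                "(norm (c * u))\<^sup>2 - (norm (c * v))\<^sup>2 = (norm c)\<^sup>2 * ((norm u)\<^sup>2 - (norm v)\<^sup>2)"
    by (simp_all add: norm_mult power_mult_distrib algebra_simps)
  ultimately show ?thesis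
    using assms unfolding hopf_def by (intro ext) (simp add: mult.left_commute)
qed

lemma hopf_0_right: "u \<noteq> 0 \<Longrightarrow> hopf u 0 = north_pole"
  by (auto simp: hopf_def north_pole_def)

lemma hopf_eq_stereo:
  assumes "v \<noteq> 0" shows "hopf u v = stereo (Some (u / v))"
proof -
  have "hopf u v = hopf (v * (u / v)) (v * 1)" using assms by simp
  also have "\<dots> = hopf (u / v) 1" by (rule hopf_scale [OF assms])
  also have "\<dots> = stereo (Some (u / v))"
    by (auto simp: hopf_def stereo_def)
  finally show ?thesis .
qed

lemma hopf_2_gt:
  assumes "u \<noteq> 0" shows "hopf u v 2 > -1"
proof -
  have "(norm u)\<^sup>2 > 0" "(norm u)\<^sup>2 + (norm v)\<^sup>2 > 0"
    using assms by (auto simp: sum_power2_gt_zero_iff)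
  then show ?thesis by (simp add: hopf_def pos_less_divide_eq)
qed

lemma continuous_on_hopf:
  assumes "continuous_on S f" "continuous_on S g" "\<And>x. x \<in> S \<Longrightarrow> f x \<noteq> 0 \<or> g x \<noteq> 0"
  shows "continuous_on S (\<lambda>x. hopf (f x) (g x))"
proof (rule continuous_on_coordinatewise_then_product)
  fix i :: nat
  have "(norm (f x))\<^sup>2 + (norm (g x))\<^sup>2 \<noteq> 0" if "x \<in> S" for x
    using assms(3) [OF that] by (auto simp: sum_power2_eq_zero_iff)
  then show "continuous_on S (\<lambda>x. hopf (f x) (g x) i)"
    using assms unfolding hopf_def
    by (cases "i = 0"; cases "i = 1"; cases "i = 2") (auto intro!: continuous_intros)
qed

lemma norm_stereo_coord:
  assumes "x \<in> topspace (nsphere 2)" "x 2 \<noteq> 1"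
  shows "(norm (stereo_coord x))\<^sup>2 = (1 + x 2) / (1 - x 2)"
proof -
  have "(x 0)\<^sup>2 + (x 1)\<^sup>2 = (1 + x 2) * (1 - x 2)"
    using assms by (simp add: topspace_nsphere_2 algebra_simps power2_eq_square)
  then have "((x 0)\<^sup>2 + (x 1)\<^sup>2) / (1 - x 2)\<^sup>2 = (1 + x 2) / (1 - x 2)"
    using assms by (simp add: power2_eq_square)
  then show ?thesis
    by (simp add: stereo_coord_def cmod_power2 power_divide add_divide_distrib)
qed

lemma height_stereo_coord:
  assumes "x \<in> topspace (nsphere 2)" "x 2 \<noteq> 1"
  shows "((norm (stereo_coord x))\<^sup>2 - 1) / ((norm (stereo_coord x))\<^sup>2 + 1) = x 2"
  using assms unfolding norm_stereo_coord [OF assms] by (simp add: field_simps)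

lemma height_mono:
  fixes a b :: real
  assumes "a \<ge> 0" "b \<ge> 0"
  shows "(a\<^sup>2 - 1) / (a\<^sup>2 + 1) \<le> (b\<^sup>2 - 1) / (b\<^sup>2 + 1) \<longleftrightarrow> a \<le> b"
proof -
  have "a\<^sup>2 + 1 > 0" "b\<^sup>2 + 1 > 0" by (simp_all add: add_nonneg_pos)
  then have "(a\<^sup>2 - 1) / (a\<^sup>2 + 1) \<le> (b\<^sup>2 - 1) / (b\<^sup>2 + 1) \<longleftrightarrow> a\<^sup>2 \<le> b\<^sup>2"
    by (simp add: field_simps)
  also have "\<dots> \<longleftrightarrow> a \<le> b" using assms by simp
  finally show ?thesis .
qed

lemma height_less_1: "(a\<^sup>2 - 1) / (a\<^sup>2 + 1) < (1::real)"
proof -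
  have "a\<^sup>2 + 1 > 0" by (simp add: add_nonneg_pos)
  then show ?thesis by simp
qed

lemma continuous_on_stereo_coord:
  assumes "continuous_on S f" "\<And>x. x \<in> S \<Longrightarrow> f x 2 \<noteq> 1"
  shows "continuous_on S (\<lambda>x. stereo_coord (f x))"
  unfolding stereo_coord_def Complex_eq
  using assms by (intro continuous_intros continuous_on_product_then_coordinatewise [OF assms(1)]) auto

text \<open>Continuity at the north pole is automatic, since the homotopy is constant in a
  neighbourhood of it.\<close>

lemma homotopic_extend_infinity:
  assumes H: "continuous_on ({0..1::real} \<times> UNIV) H"
    and im: "\<And>t z. t \<in> {0..1} \<Longrightarrow> H (t, z) \<in> topspace (nsphere 2)"
    and r: "r > 0" and out: "\<And>t z. \<lbrakk>t \<in> {0..1}; norm z \<ge> r\<rbrakk> \<Longrightarrow> H (t, z) = north_pole"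
  shows "homotopic_with (\<lambda>x. True) (nsphere 2) (nsphere 2)
          (extend_infinity (\<lambda>z. H (0, z))) (extend_infinity (\<lambda>z. H (1, z)))"
proof (rule homotopic_nsphere_mapsI [where H = "\<lambda>(t, x). extend_infinity (\<lambda>z. H (t, z)) x"])
  let ?S = "topspace (nsphere 2)"
  let ?K = "\<lambda>(t, x). extend_infinity (\<lambda>z. H (t, z)) x"
  \<comment> \<open>The height on the sphere of the circle of radius \<open>r\<close>. Gluing along
    this level keeps \<open>stereo_coord\<close> away from the pole, where it would divide by
    0.\<close>
  define b where "b = (r\<^sup>2 - 1) / (r\<^sup>2 + 1)"
  have b1: "b < 1" unfolding b_def by (rule height_less_1)
  have big: "norm (stereo_coord x) \<ge> r" if "x \<in> ?S" "x 2 \<noteq> 1" "b \<le> x 2" for x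
    using that height_stereo_coord [OF that(1,2)] height_mono [of r "norm (stereo_coord x)"] r
    by (simp add: b_def)
  have "continuous_on ({0..1} \<times> ?S)
      (\<lambda>p. if snd p 2 \<le> b then H (fst p, stereo_coord (snd p)) else north_pole)"
  proof (rule continuous_on_cases_le)
    have "continuous_on {p \<in> {0..1} \<times> ?S. snd p 2 \<le> b} (\<lambda>p. stereo_coord (snd p))"
      using b1 by (intro continuous_on_stereo_coord continuous_intros) auto
    then show "continuous_on {p \<in> {0..1} \<times> ?S. snd p 2 \<le> b} (\<lambda>p. H (fst p, stereo_coord (snd p)))"
      by (intro continuous_on_compose2 [OF H] continuous_intros) auto
    show "continuous_on ({0..1} \<times> ?S) (\<lambda>p. snd p 2)"
      by (intro continuous_on_product_then_coordinatewise [where f=snd] continuous_intros)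
    show "H (fst p, stereo_coord (snd p)) = north_pole" if "p \<in> {0..1} \<times> ?S" "snd p 2 = b" for p
      using that b1 by (intro out big) auto
  qed auto
  moreover have "(if snd p 2 \<le> b then H (fst p, stereo_coord (snd p)) else north_pole) = ?K p"
    if "p \<in> {0..1} \<times> ?S" for p
    using that b1 out big by (auto simp: extend_infinity_def)
  ultimately show "continuous_on ({0..1} \<times> ?S) ?K"
    by (simp cong: continuous_on_cong)
  show "?K (t, x) \<in> ?S" if "t \<in> {0..1}" "x \<in> ?S" for t x
    using that im by (auto simp: extend_infinity_def)
qed auto

section \<open>Pairs whose second coordinate vanishes outside a disc\<close>

definition pair_map :: "(complex \<Rightarrow> complex) \<Rightarrow> (complex \<Rightarrow> complex) \<Rightarrow> (nat \<Rightarrow> real) \<Rightarrow> nat \<Rightarrow> real" where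
  "pair_map f g = extend_infinity (\<lambda>z. hopf (f z) (g z))"

lemma continuous_map_pair_map:
  assumes "continuous_on UNIV f" "continuous_on UNIV g" "\<And>z. f z \<noteq> 0 \<or> g z \<noteq> 0"
    and "r > 0" "\<And>z. norm z \<ge> r \<Longrightarrow> g z = 0"
  shows "continuous_map (nsphere 2) (nsphere 2) (pair_map f g)"
proof -
  \<comment> \<open>A homotopy that does not depend on time: its existence contains the continuity
    of the map.\<close>
  have "homotopic_with (\<lambda>x. True) (nsphere 2) (nsphere 2)
      (extend_infinity (\<lambda>z. hopf (f (snd (0::real, z))) (g (snd (0::real, z)))))
      (extend_infinity (\<lambda>z. hopf (f (snd (1::real, z))) (g (snd (1::real, z)))))"
  proof (rule homotopic_extend_infinity [where H = "\<lambda>p. hopf (f (snd p)) (g (snd p))" and r=r])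
    show "continuous_on ({0..1} \<times> UNIV) (\<lambda>p. hopf (f (snd p)) (g (snd p)))"
      using assms(3)
      by (intro continuous_on_hopf continuous_on_compose2 [OF assms(1)] continuous_on_compose2 [OF assms(2)] continuous_intros) auto
    show "hopf (f (snd (t, z))) (g (snd (t, z))) = north_pole" if "norm z \<ge> r" for t :: real and z
      using assms(3) [of z] assms(5) [OF that] by (simp add: hopf_0_right)
  qed (use assms in \<open>auto simp: hopf_in_nsphere\<close>)
  then show ?thesis
    unfolding pair_map_def using homotopic_with_imp_continuous_maps by fastforce
qed

text \<open>The map [u : v] to [u : l v], written in sphere coordinates so that it can be applied to a map
  near points (infinity) where no representation by a pair u, v is available.\<close>
definition shrink :: "real \<Rightarrow> (nat \<Rightarrow> real) \<Rightarrow> nat \<Rightarrow> real" where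
  "shrink l y = (\<lambda>i. (if i = 2 then (1 + y 2) - l\<^sup>2 * (1 - y 2) else 2 * l * y i)
                       / ((1 + y 2) + l\<^sup>2 * (1 - y 2)))"

text \<open>The excluded case is u = 0 (the south pole) together with l = 0, exactly when [u : l v]
  would become the meaningless [0 : 0].\<close>

lemma shrink_denominator:
  assumes "y \<in> topspace (nsphere 2)" "l \<noteq> 0 \<or> y 2 \<noteq> -1"
  shows "(1 + y 2) + l\<^sup>2 * (1 - y 2) > 0"
proof (cases "y 2 = -1")
  case True
  then show ?thesis using assms by simp
next
  case False
  then have "1 + y 2 > 0" "1 - y 2 \<ge> 0" using nsphere_2_bounds [OF assms(1)] by auto
  then show ?thesis by (simp add: add_pos_nonneg)
qed

lemma shrink_in_nsphere:
  assumes "y \<in> topspace (nsphere 2)" "l \<noteq> 0 \<or> y 2 \<noteq> -1"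
  shows "shrink l y \<in> topspace (nsphere 2)"
proof -
  define D where "D = (1 + y 2) + l\<^sup>2 * (1 - y 2)"
  have D: "D \<noteq> 0" using shrink_denominator [OF assms] by (simp add: D_def)
  have y: "(y 0)\<^sup>2 + (y 1)\<^sup>2 + (y 2)\<^sup>2 = 1" "\<forall>i>2. y i = 0" using assms(1) by (auto simp: topspace_nsphere_2)
  have "(2 * l * y 0)\<^sup>2 + (2 * l * y 1)\<^sup>2 = 4 * l\<^sup>2 * ((y 0)\<^sup>2 + (y 1)\<^sup>2)"
    by (simp add: power_mult_distrib algebra_simps)
  also have "(y 0)\<^sup>2 + (y 1)\<^sup>2 = (1 + y 2) * (1 - y 2)"
    using y(1) by (simp add: power2_eq_square algebra_simps)
  finally have "(2 * l * y 0)\<^sup>2 + (2 * l * y 1)\<^sup>2 + ((1 + y 2) - l\<^sup>2 * (1 - y 2))\<^sup>2 = D\<^sup>2"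
    unfolding D_def by (simp add: power2_eq_square algebra_simps)
  then have "(2 * l * y 0 / D)\<^sup>2 + (2 * l * y 1 / D)\<^sup>2 + (((1 + y 2) - l\<^sup>2 * (1 - y 2)) / D)\<^sup>2 = 1"
    using D by (simp only: power_divide add_divide_distrib [symmetric]) simp
  then show ?thesis
    using y(2) by (simp add: topspace_nsphere_2 shrink_def D_def)
qed

lemma shrink_1: "shrink 1 y = y"
  by (auto simp: shrink_def)

lemma shrink_0: "y 2 \<noteq> -1 \<Longrightarrow> shrink 0 y = north_pole"
  by (auto simp: shrink_def north_pole_def fun_eq_iff)

lemma shrink_hopf:
  assumes "u \<noteq> 0 \<or> l \<noteq> 0 \<and> v \<noteq> 0"
  shows "shrink l (hopf u v) = hopf u (of_real l * v)"
proof -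
  define N where "N = (norm u)\<^sup>2 + (norm v)\<^sup>2"
  have N: "N > 0" using assms unfolding N_def by (metis sum_power2_gt_zero_iff norm_eq_zero)
  have "hopf u v 2 = ((norm u)\<^sup>2 - (norm v)\<^sup>2) / N"
    by (simp add: hopf_def N_def)
  then have "1 + hopf u v 2 = (N + ((norm u)\<^sup>2 - (norm v)\<^sup>2)) / N" "1 - hopf u v 2 = (N - ((norm u)\<^sup>2 - (norm v)\<^sup>2)) / N"
    using N by (simp_all add: add_divide_distrib diff_divide_distrib)
  \<comment> \<open>This is the origin of the formula for \<open>shrink\<close>: up to the factor 2
    / N, the numbers 1 + y 2 and 1 - y 2 are the squared norms of u and v, so scaling v by l
    multiplies the second by the square of l.\<close>
  then have 1: "1 + hopf u v 2 = 2 * (norm u)\<^sup>2 / N" "1 - hopf u v 2 = 2 * (norm v)\<^sup>2 / N"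
    by (simp_all add: N_def)
  have n: "(norm (of_real l * v))\<^sup>2 = l\<^sup>2 * (norm v)\<^sup>2"
    by (simp add: norm_mult power_mult_distrib)
  have c: "u * cnj (of_real l * v) = of_real l * (u * cnj v)" by simp
  have D: "(1 + hopf u v 2) + l\<^sup>2 * (1 - hopf u v 2) = 2 / N * ((norm u)\<^sup>2 + (norm (of_real l * v))\<^sup>2)"
          "(1 + hopf u v 2) - l\<^sup>2 * (1 - hopf u v 2) = 2 / N * ((norm u)\<^sup>2 - (norm (of_real l * v))\<^sup>2)"
    unfolding 1 n by (simp_all add: algebra_simps)
  have h: "hopf u v 0 = 2 * Re (u * cnj v) / N" "hopf u v 1 = 2 * Im (u * cnj v) / N"
    by (simp_all add: hopf_def N_def)
  have l: "Re (of_real l * w) = l * Re w" "Im (of_real l * w) = l * Im w" for w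
    by simp_all
  have z: "2 * l * hopf u v 0 = 2 / N * (2 * Re (u * cnj (of_real l * v)))"
               "2 * l * hopf u v 1 = 2 / N * (2 * Im (u * cnj (of_real l * v)))"
    unfolding c h l by (simp_all only: times_divide_eq_left times_divide_eq_right mult_ac)
  have "2 / N \<noteq> 0" using N by simp
  then have cancel: "2 / N * a / (2 / N * b) = a / b" for a b by simp
  show ?thesis
  proof
    fix i :: nat
    show "shrink l (hopf u v) i = hopf u (of_real l * v) i"
      unfolding shrink_def D
      using z cancel by (auto simp: hopf_def simp del: times_divide_eq_left)
  qed
qed

text \<open>The homotopy scales the second coordinate from 1 down to \<open>c\<close>. The factor is
  0 only at the final time and outside the open disc, where \<open>fr\<close>, and
  \<open>north\<close> at infinity itself, keep \<open>R\<close> off the south pole.\<close>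

lemma Brouwer_degree2_pair_map_cutoff:
  assumes R: "continuous_map (nsphere 2) (nsphere 2) R"
    and eq: "\<And>x. \<lbrakk>x \<in> topspace (nsphere 2); x 2 \<noteq> 1\<rbrakk> \<Longrightarrow> R x = hopf (f (stereo_coord x)) (g (stereo_coord x))"
    and nz: "\<And>z. f z \<noteq> 0 \<or> g z \<noteq> 0"
    and r: "r > 0" and fr: "\<And>z. norm z \<ge> r \<Longrightarrow> f z \<noteq> 0"
    and north: "R north_pole 2 \<noteq> -1"
  obtains c where "continuous_on UNIV c" "\<And>z. norm z \<ge> r \<Longrightarrow> c z = 0" "\<And>z. norm z < r \<Longrightarrow> c z \<noteq> 0"
    "Brouwer_degree2 2 R = Brouwer_degree2 2 (pair_map f (\<lambda>z. complex_of_real (c z) * g z))"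
proof
  let ?S = "topspace (nsphere 2)"
  define b where "b = (r\<^sup>2 - 1) / (r\<^sup>2 + 1)"
  \<comment> \<open>Defined through the height on the sphere, so that it extends continuously over
    the north pole.\<close>
  define c where "c z = max 0 (b - ((norm z)\<^sup>2 - 1) / ((norm z)\<^sup>2 + 1))" for z :: complex
  have b1: "b < 1" unfolding b_def by (rule height_less_1)
  have "(norm z)\<^sup>2 + 1 \<noteq> 0" for z :: complex
    by (metis add_nonneg_pos less_irrefl zero_le_power2 zero_less_one)
  then show "continuous_on UNIV c"
    unfolding c_def by (intro continuous_intros) auto
  show "c z = 0" if "norm z \<ge> r" for z
    using that height_mono [of r "norm z"] r by (simp add: c_def b_def)
  show cnz: "c z \<noteq> 0" if "norm z < r" for z
    using that height_mono [of r "norm z"] r by (simp add: c_def b_def)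
  have RS: "continuous_on ?S R" "R \<in> ?S \<rightarrow> ?S"
    using R by (auto simp: continuous_map_nsphere_iff)
  have south: "R x 2 \<noteq> -1" if "x \<in> ?S" "b \<le> x 2" for x
  proof (cases "x 2 = 1")
    case True
    then show ?thesis using nsphere_2_north that north by metis
  next
    case False
    then have "norm (stereo_coord x) \<ge> r"
      using that height_stereo_coord [OF that(1) False] height_mono [of r "norm (stereo_coord x)"] r
      by (simp add: b_def)
    then show ?thesis
      using hopf_2_gt [OF fr] eq [OF that(1) False] by (metis less_irrefl)
  qed
  \<comment> \<open>The segment from 1 to the cutoff, with the latter read off from the height
    \<open>x 2\<close> instead of z.\<close>
  define l where "l = (\<lambda>(t::real, x :: nat \<Rightarrow> real). (1 - t) + t * max 0 (b - x 2))"
  have ok: "l (t, x) \<noteq> 0 \<or> R x 2 \<noteq> -1" if "t \<in> {0..1}" "x \<in> ?S" for t x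
  proof (cases "b \<le> x 2")
    case True
    then show ?thesis using south that by blast
  next
    case False
    then have "l (t, x) > 0"
      using that by (cases "t = 1") (auto simp: l_def intro: add_pos_nonneg)
    then show ?thesis by simp
  qed
  have "homotopic_with (\<lambda>x. True) (nsphere 2) (nsphere 2) R (pair_map f (\<lambda>z. complex_of_real (c z) * g z))"
  proof (rule homotopic_nsphere_mapsI)
    let ?H = "\<lambda>p. shrink (l p) (R (snd p))"
    have contR: "continuous_on ({0..1} \<times> ?S) (\<lambda>p. R (snd p) i)" for i
      by (intro continuous_on_product_then_coordinatewise [where f="\<lambda>p. R (snd p)"]
           continuous_on_compose2 [OF RS(1)] continuous_intros) auto
    have contl: "continuous_on ({0..1} \<times> ?S) l"
      unfolding l_def case_prod_unfold
      by (intro continuous_intros continuous_on_product_then_coordinatewise [where f=snd])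
    show "continuous_on ({0..1} \<times> ?S) ?H"
    proof (rule continuous_on_coordinatewise_then_product)
      fix i :: nat
      have "1 + R (snd p) 2 + (l p)\<^sup>2 * (1 - R (snd p) 2) \<noteq> 0" if "p \<in> {0..1} \<times> ?S" for p
        using shrink_denominator [of "R (snd p)" "l p"] ok [of "fst p" "snd p"] that RS(2)
        by (force simp: Pi_iff)
      then show "continuous_on ({0..1} \<times> ?S) (\<lambda>p. ?H p i)"
        unfolding shrink_def
        by (cases "i = 2") (auto intro!: continuous_intros contR contl)
    qed
    show "?H (t, x) \<in> ?S" if "t \<in> {0..1}" "x \<in> ?S" for t x
      using ok [OF that] that RS(2) by (auto intro!: shrink_in_nsphere)
    show "?H (0, x) = R x" for x by (simp add: l_def shrink_1)
    show "?H (1, x) = pair_map f (\<lambda>z. complex_of_real (c z) * g z) x" if x: "x \<in> ?S" for x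
    proof (cases "x 2 = 1")
      case True
      then show ?thesis
        using b1 south [OF x] by (simp add: l_def pair_map_def extend_infinity_def shrink_0)
    next
      case False
      let ?z = "stereo_coord x"
      have "l (1, x) = c ?z"
        using height_stereo_coord [OF x False] by (simp add: l_def c_def)
      moreover have "f ?z \<noteq> 0 \<or> c ?z \<noteq> 0 \<and> g ?z \<noteq> 0"
        using fr cnz nz by (meson not_le)
      ultimately show ?thesis
        using False by (simp add: pair_map_def extend_infinity_def eq [OF x] shrink_hopf)
    qed
  qed
  then show "Brouwer_degree2 2 R = Brouwer_degree2 2 (pair_map f (\<lambda>z. complex_of_real (c z) * g z))"
    by (rule Brouwer_degree2_homotopic)
qed

subsection \<open>Homotopy classification of pairs\<close>

lemma path_circle_comp:
  assumes "continuous_on UNIV f"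
  shows "path (\<lambda>t. f (complex_of_real r * cis (2 * pi * t)))"
    and "pathfinish (\<lambda>t. f (complex_of_real r * cis (2 * pi * t))) = pathstart (\<lambda>t. f (complex_of_real r * cis (2 * pi * t)))"
proof -
  show "path (\<lambda>t. f (complex_of_real r * cis (2 * pi * t)))"
    unfolding path_def by (intro continuous_on_compose2 [OF assms] continuous_intros) auto
  have "cis (2 * pi) = 1" by (simp add: complex_eq_iff)
  then show "pathfinish (\<lambda>t. f (complex_of_real r * cis (2 * pi * t))) = pathstart (\<lambda>t. f (complex_of_real r * cis (2 * pi * t)))"
    by (simp add: pathfinish_def pathstart_def)
qed

text \<open>There is no obstruction because the domain has dimension 3 and the sphere in C^2 also
  has dimension 3, being the frontier of a 4-dimensional ball.\<close>

lemma extend_map_cylinder_to_sphere: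
  fixes F :: "real \<times> complex \<Rightarrow> complex \<times> complex"
  assumes S: "closed S" "S \<subseteq> {0..1} \<times> cball 0 r"
    and F: "continuous_on S F" "\<And>x. x \<in> S \<Longrightarrow> F x \<noteq> 0"
  obtains G where "continuous_on ({0..1} \<times> cball 0 r) G"
    "\<And>x. x \<in> {0..1} \<times> cball 0 r \<Longrightarrow> G x \<noteq> 0"
    "\<And>x. x \<in> S \<Longrightarrow> G x = F x /\<^sub>R norm (F x)"
proof -
  \<comment> \<open>The extension theorem works on polytopes, and the round cylinder is not one; a
    surrounding box is, and serves as a cell complex with a single cell.\<close>
  define K where "K = cbox (0::real, Complex (-r) (-r)) (1, Complex r r)"
  have K: "{0..1} \<times> cball 0 r \<subseteq> K"
  proof
    fix p :: "real \<times> complex" assume p: "p \<in> {0..1} \<times> cball 0 r"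
    then have "\<bar>Re (snd p)\<bar> \<le> r" "\<bar>Im (snd p)\<bar> \<le> r"
      using abs_Re_le_cmod [of "snd p"] abs_Im_le_cmod [of "snd p"] by auto
    with p show "p \<in> K"
      by (auto simp: K_def cbox_Pair_eq in_cbox_complex_iff abs_le_iff)
  qed
  have "aff_dim K \<le> 3"
    using aff_dim_le_DIM [of K] by simp
  moreover have "aff_dim (cball 0 1 :: (complex \<times> complex) set) = 4"
    using aff_dim_cball [of 1 "0 :: complex \<times> complex"] by simp
  moreover have "rel_frontier (cball 0 1 :: (complex \<times> complex) set) = sphere 0 1"
    by (metis frontier_cball rel_frontier_nonempty_interior interior_cball ball_eq_empty not_one_le_zero)
  ultimately obtain G where G: "continuous_on K G" "G \<in> K \<rightarrow> sphere 0 1"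
    "\<And>x. x \<in> S \<Longrightarrow> G x = F x /\<^sub>R norm (F x)"
  proof (rule_tac extend_map_cell_complex_to_sphere [of "{K}" S "cball 0 1 :: (complex \<times> complex) set" "\<lambda>x. F x /\<^sub>R norm (F x)"])
    show "continuous_on S (\<lambda>x. F x /\<^sub>R norm (F x))"
      using F by (intro continuous_intros) auto
    show "\<And>X Y. \<lbrakk>X \<in> {K}; Y \<in> {K}\<rbrakk> \<Longrightarrow> X \<inter> Y face_of X"
      by (auto simp: K_def face_of_refl)
    show "\<And>X. X \<in> {K} \<Longrightarrow> polytope X"
      by (auto simp: K_def polytope_interval)
  qed (use S K F in auto)
  show thesis
  proof
    show "continuous_on ({0..1} \<times> cball 0 r) G"
      using G(1) K continuous_on_subset by blast
    show "G x \<noteq> 0" if "x \<in> {0..1} \<times> cball 0 r" for x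
      using G(2) K that by (force simp: Pi_iff)
  qed (use G in auto)
qed

lemma hopf_normalize:
  assumes "p \<noteq> 0"
  shows "hopf (fst (p /\<^sub>R norm p)) (snd (p /\<^sub>R norm p)) = hopf (fst p) (snd p)"
  using assms hopf_scale [of "of_real (inverse (norm p))"] by (simp add: scaleR_conv_of_real)

text \<open>The two pairs are prescribed on the bottom and top of a solid cylinder, and a homotopy
  of their boundary loops on its side. Extending to the inside without zeros gives a homotopy of
  maps to the Riemann sphere.\<close>

proposition Brouwer_degree2_pair_map_cong:
  assumes f0: "continuous_on UNIV f0" and g0: "continuous_on UNIV g0" and nz0: "\<And>z. f0 z \<noteq> 0 \<or> g0 z \<noteq> 0"
    and f1: "continuous_on UNIV f1" and g1: "continuous_on UNIV g1" and nz1: "\<And>z. f1 z \<noteq> 0 \<or> g1 z \<noteq> 0"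
    and r: "r > 0" and out0: "\<And>z. norm z \<ge> r \<Longrightarrow> g0 z = 0" and out1: "\<And>z. norm z \<ge> r \<Longrightarrow> g1 z = 0"
    and wn: "winding_number (\<lambda>t. f0 (of_real r * cis (2 * pi * t))) 0 = winding_number (\<lambda>t. f1 (of_real r * cis (2 * pi * t))) 0"
  shows "Brouwer_degree2 2 (pair_map f0 g0) = Brouwer_degree2 2 (pair_map f1 g1)"
proof -
  let ?p0 = "\<lambda>t. f0 (of_real r * cis (2 * pi * t))" and ?p1 = "\<lambda>t. f1 (of_real r * cis (2 * pi * t))"
  have fnz: "f0 z \<noteq> 0" "f1 z \<noteq> 0" if "norm z \<ge> r" for z
    using nz0 nz1 out0 out1 that by metis+
  have "homotopic_loops (-{0}) ?p0 ?p1"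
    using wn r fnz path_circle_comp [OF f0] path_circle_comp [OF f1]
    by (subst winding_number_homotopic_loops_eq [symmetric]) (auto simp: path_image_def norm_mult)
  \<comment> \<open>\<open>Arg2pi\<close> turns loops on the unit interval into maps of the circle,
    the form needed on the side of the cylinder.\<close>
  then have "homotopic_with_canon (\<lambda>h. True) (sphere 0 1) (-{0})
               (?p0 \<circ> (\<lambda>z. Arg2pi z / (2 * pi))) (?p1 \<circ> (\<lambda>z. Arg2pi z / (2 * pi)))"
    by (rule homotopic_loops_imp_homotopic_circlemaps)
  then obtain k where k: "continuous_on ({0..1::real} \<times> sphere 0 1) k" "k \<in> {0..1} \<times> sphere 0 1 \<rightarrow> -{0}"
     and k01: "\<And>z. k (0, z) = ?p0 (Arg2pi z / (2 * pi))" "\<And>z. k (1, z) = ?p1 (Arg2pi z / (2 * pi))"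
    by (auto simp: homotopic_with_def continuous_map_in_subtopology)
  have "cis (Arg2pi z) = z" if "norm z = 1" for z
    using Arg2pi_eq [of z] that by (simp add: cis_conv_exp)
  then have k0: "k (0, z) = f0 (of_real r * z)" and k1: "k (1, z) = f1 (of_real r * z)" if "norm z = 1" for z
    using that by (simp_all add: k01)
  let ?D = "cball 0 r :: complex set"
  define S where "S = ({0::real} \<times> ?D \<union> {1} \<times> ?D) \<union> {0..1} \<times> sphere 0 r"
  \<comment> \<open>On the rims the first branch wins; it agrees with the others because the second
    coordinates vanish there and \<open>k\<close> starts and ends with the given loops.\<close>
  define F where "F = (\<lambda>(t, z). if norm z = r then (k (t, z / of_real r), 0)
                        else if t = (0::real) then (f0 z, g0 z) else (f1 z, g1 z))"
  have F0: "F (0, z) = (f0 z, g0 z)" and F1: "F (1, z) = (f1 z, g1 z)" for z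
    using r out0 out1 k0 [of "z / of_real r"] k1 [of "z / of_real r"]
    by (auto simp: F_def norm_divide)
  obtain G where G: "continuous_on ({0..1} \<times> ?D) G"
    "\<And>x. x \<in> {0..1} \<times> ?D \<Longrightarrow> G x \<noteq> 0"
    "\<And>x. x \<in> S \<Longrightarrow> G x = F x /\<^sub>R norm (F x)"
  proof (rule extend_map_cylinder_to_sphere [of S r F])
    show "closed S"
      unfolding S_def by (intro closed_Un closed_Times) auto
    show "S \<subseteq> {0..1} \<times> ?D"
      by (auto simp: S_def)
    show "continuous_on S F"
      unfolding S_def
    proof (intro continuous_on_closed_Un)
      have "continuous_on ({0::real} \<times> ?D) (\<lambda>p. (f0 (snd p), g0 (snd p)))"
        by (intro continuous_intros continuous_on_compose2 [OF f0] continuous_on_compose2 [OF g0]) auto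
      then show "continuous_on ({0} \<times> ?D) F"
        by (rule continuous_on_eq) (auto simp: F0)
      have "continuous_on ({1::real} \<times> ?D) (\<lambda>p. (f1 (snd p), g1 (snd p)))"
        by (intro continuous_intros continuous_on_compose2 [OF f1] continuous_on_compose2 [OF g1]) auto
      then show "continuous_on ({1} \<times> ?D) F"
        by (rule continuous_on_eq) (auto simp: F1)
      have "continuous_on ({0..1::real} \<times> sphere 0 r) (\<lambda>p. (k (fst p, snd p / of_real r), 0::complex))"
        using r by (intro continuous_intros continuous_on_compose2 [OF k(1)]) (auto simp: norm_divide)
      then show "continuous_on ({0..1} \<times> sphere 0 r) F"
        by (rule continuous_on_eq) (auto simp: F_def)
    qed (auto intro!: closed_Un closed_Times)
    show "F x \<noteq> 0" if "x \<in> S" for x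
    proof -
      obtain t z where x: "x = (t, z)" by force
      have "k (t, z / of_real r) \<noteq> 0" if "norm z = r" "t \<in> {0..1}"
        using k(2) that r by (auto simp: Pi_iff norm_divide)
      then show ?thesis
        using that nz0 [of z] nz1 [of z] by (auto simp: x S_def F_def zero_prod_def)
    qed
  qed blast
  \<comment> \<open>On the side of the cylinder \<open>G\<close> is a positive multiple of (k, 0),
    that is the point infinity, so the constant continuation outside the disc fits.\<close>
  define H where "H = (\<lambda>p. if norm (snd p) \<le> r then hopf (fst (G p)) (snd (G p)) else north_pole)"
  have bd: "hopf (fst (G (t, z))) (snd (G (t, z))) = north_pole" if "t \<in> {0..1}" "norm z = r" for t z
  proof -
    have "(t, z) \<in> S" using that by (simp add: S_def)
    moreover have "k (t, z / of_real r) \<noteq> 0"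
      using k(2) that r by (auto simp: Pi_iff norm_divide)
    moreover have "F (t, z) = (k (t, z / of_real r), 0)"
      using that by (simp add: F_def)
    ultimately show ?thesis
      using G(3) [of "(t, z)"] hopf_normalize [of "F (t, z)"] by (simp add: zero_prod_def hopf_0_right)
  qed
  have "homotopic_with (\<lambda>x. True) (nsphere 2) (nsphere 2)
      (extend_infinity (\<lambda>z. H (0, z))) (extend_infinity (\<lambda>z. H (1, z)))"
  proof (rule homotopic_extend_infinity [OF _ _ r])
    show "continuous_on ({0..1::real} \<times> UNIV) H"
      unfolding H_def
    proof (rule continuous_on_cases_le)
      have "{p \<in> {0..1} \<times> UNIV. norm (snd p) \<le> r} = {0..1} \<times> ?D" by auto
      then show "continuous_on {p \<in> {0..1} \<times> UNIV. norm (snd p) \<le> r} (\<lambda>p. hopf (fst (G p)) (snd (G p)))"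
        using G(2) by (auto intro!: continuous_on_hopf continuous_on_fst continuous_on_snd G(1) simp: prod_eq_iff)
      show "continuous_on ({0..1::real} \<times> UNIV) (\<lambda>p. norm (snd p :: complex))"
        by (intro continuous_intros)
    qed (use bd in auto)
    show "H (t, z) \<in> topspace (nsphere 2)" if "t \<in> {0..1}" for t z
      using that G(2) [of "(t, z)"] by (auto simp: H_def prod_eq_iff intro!: hopf_in_nsphere)
    show "H (t, z) = north_pole" if "t \<in> {0..1}" "norm z \<ge> r" for t z
      using that bd by (simp add: H_def)
  qed
  moreover have "H (0, z) = hopf (f0 z) (g0 z)" for z
  proof (cases "norm z \<le> r")
    case True
    then have "(0, z) \<in> S" by (simp add: S_def)
    then show ?thesis
      using True G(3) [of "(0, z)"] hopf_normalize [of "F (0, z)"] nz0 [of z] by (simp add: H_def F0 zero_prod_def)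
  next
    case False
    then show ?thesis using fnz out0 by (simp add: H_def hopf_0_right)
  qed
  moreover have "H (1, z) = hopf (f1 z) (g1 z)" for z
  proof (cases "norm z \<le> r")
    case True
    then have "(1, z) \<in> S" by (simp add: S_def)
    then show ?thesis
      using True G(3) [of "(1, z)"] hopf_normalize [of "F (1, z)"] nz1 [of z] by (simp add: H_def F1 zero_prod_def)
  next
    case False
    then show ?thesis using fnz out1 by (simp add: H_def hopf_0_right)
  qed
  ultimately have "homotopic_with (\<lambda>x. True) (nsphere 2) (nsphere 2) (pair_map f0 g0) (pair_map f1 g1)"
    by (simp add: pair_map_def)
  then show ?thesis
    by (rule Brouwer_degree2_homotopic)
qed

subsection \<open>Degree as a winding number\<close>

lemma hopf_stereo_coord:
  assumes x: "x \<in> topspace (nsphere 2)" "x 2 \<noteq> 1"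
  shows "hopf (stereo_coord x) 1 = x"
proof
  fix i :: nat
  have n: "(norm (stereo_coord x))\<^sup>2 + 1 = 2 / (1 - x 2)"
    using x unfolding norm_stereo_coord [OF x] by (simp add: field_simps)
  have i: "i = 0 \<or> i = 1 \<or> i = 2 \<or> i > 2" by linarith
  have "hopf (stereo_coord x) 1 2 = x 2"
    using height_stereo_coord [OF x] by (simp add: hopf_def)
  moreover have "hopf (stereo_coord x) 1 0 = x 0" "hopf (stereo_coord x) 1 1 = x 1"
    using x n by (simp_all add: hopf_def) (simp_all add: stereo_coord_def)
  moreover have "hopf (stereo_coord x) 1 i = x i" if "i > 2"
    using x that by (simp add: hopf_def topspace_nsphere_2)
  ultimately show "hopf (stereo_coord x) 1 i = x i"
    using i by auto
qed

text \<open>The model [e : 1] has a second coordinate that vanishes nowhere; the cutoff brings it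
  into the form that can be compared by winding numbers.\<close>

lemma Brouwer_degree2_pair_map_of_model:
  assumes R: "continuous_map (nsphere 2) (nsphere 2) R"
    and eq: "\<And>x. \<lbrakk>x \<in> topspace (nsphere 2); x 2 \<noteq> 1\<rbrakk> \<Longrightarrow> R x = hopf (e (stereo_coord x)) 1"
    and e: "continuous_on UNIV e" "\<And>z. e z = 0 \<longleftrightarrow> z = 0" and north: "R north_pole 2 \<noteq> -1"
    and r: "r > 0"
    and f: "continuous_on UNIV f" and g: "continuous_on UNIV g" and nz: "\<And>z. f z \<noteq> 0 \<or> g z \<noteq> 0"
    and out: "\<And>z. norm z \<ge> r \<Longrightarrow> g z = 0"
    and wn: "winding_number (\<lambda>t. f (of_real r * cis (2 * pi * t))) 0 = winding_number (\<lambda>t. e (of_real r * cis (2 * pi * t))) 0"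
  shows "Brouwer_degree2 2 (pair_map f g) = Brouwer_degree2 2 R"
proof -
  obtain c where c: "continuous_on UNIV c" "\<And>z. norm z \<ge> r \<Longrightarrow> c z = 0" "\<And>z. norm z < r \<Longrightarrow> c z \<noteq> 0"
    and deg: "Brouwer_degree2 2 R = Brouwer_degree2 2 (pair_map e (\<lambda>z. complex_of_real (c z) * 1))"
  proof (rule Brouwer_degree2_pair_map_cutoff [OF R, of e "\<lambda>z. 1" r])
    show "e z \<noteq> 0" if "norm z \<ge> r" for z
      using that r e(2) [of z] by auto
  qed (use eq r north in auto)
  have "Brouwer_degree2 2 (pair_map f g) = Brouwer_degree2 2 (pair_map e (\<lambda>z. complex_of_real (c z) * 1))"
  proof (rule Brouwer_degree2_pair_map_cong [OF f g nz e(1) _ _ r out _ wn])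
    show "continuous_on UNIV (\<lambda>z. complex_of_real (c z) * 1)"
      using c(1) by (intro continuous_intros)
    show "e z \<noteq> 0 \<or> complex_of_real (c z) * 1 \<noteq> 0" for z
      using e(2) [of z] c(3) [of 0] r by auto
  qed (use c in auto)
  then show ?thesis using deg by simp
qed

text \<open>The comparison map for n + 1 is the product [f1 f2 : g1 f2 + g2 f1] of [f1 : g1] and
  [f2 : g2], which equal infinity on the closed lower and upper half-plane respectively; there the
  product reduces to the other factor, so degrees add.\<close>
lemma Brouwer_degree2_pair_map_multiple:
  fixes s :: int
  assumes r: "r > 0"
    and e: "continuous_on UNIV e" "\<And>z. e z = 0 \<longleftrightarrow> z = 0"
    and we: "\<And>a. norm a < r \<Longrightarrow> winding_number (\<lambda>t. e (of_real r * cis (2 * pi * t) - a)) 0 = of_int s"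
    and one: "\<And>f g. \<lbrakk>continuous_on UNIV f; continuous_on UNIV g; \<And>z. f z \<noteq> 0 \<or> g z \<noteq> 0;
        \<And>z. norm z \<ge> r \<Longrightarrow> g z = 0; winding_number (\<lambda>t. f (of_real r * cis (2 * pi * t))) 0 = of_int s\<rbrakk>
       \<Longrightarrow> Brouwer_degree2 2 (pair_map f g) = s"
    and f: "continuous_on UNIV f" and g: "continuous_on UNIV g" and nz: "\<And>z. f z \<noteq> 0 \<or> g z \<noteq> 0"
    and out: "\<And>z. norm z \<ge> r \<Longrightarrow> g z = 0"
    and wn: "winding_number (\<lambda>t. f (of_real r * cis (2 * pi * t))) 0 = of_int (int n * s)"
  shows "Brouwer_degree2 2 (pair_map f g) = int n * s"
  using f g nz out wn
proof (induction n arbitrary: f g)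
  case 0
  have "Brouwer_degree2 2 (pair_map f g) = Brouwer_degree2 2 (pair_map (\<lambda>z. 1) (\<lambda>z. 0))"
    by (rule Brouwer_degree2_pair_map_cong [OF 0(1-3) _ _ _ r 0(4)])
       (use 0(5) in \<open>auto simp: winding_number_const\<close>)
  also have "pair_map (\<lambda>z. 1) (\<lambda>z. 0) = (\<lambda>x. north_pole)"
    by (auto simp: pair_map_def extend_infinity_def hopf_0_right)
  finally show ?case
    by (simp add: Brouwer_degree2_const)
next
  case (Suc n)
  \<comment> \<open>The bumps \<open>g1\<close> and \<open>g2\<close> have radius r/2 and centres
    \<open>a\<close> and \<open>-a\<close> on the imaginary axis. Their open supports thus lie in
    the open upper and lower half-plane and inside the disc of radius \<open>r\<close>.\<close>
  define a where "a = \<i> * of_real (r / 2)"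
  have a: "norm a = r / 2" using r by (simp add: a_def norm_mult)
  define f1 g1 where "f1 = (\<lambda>z. e (z - a))" and "g1 = (\<lambda>z. complex_of_real (max 0 (r / 2 - norm (z - a))))"
  define f2 g2 where "f2 = (\<lambda>z. e (z + a) ^ n)" and "g2 = (\<lambda>z. complex_of_real (max 0 (r / 2 - norm (z + a))))"
  define F G where "F = (\<lambda>z. f1 z * f2 z)" and "G = (\<lambda>z. g1 z * f2 z + g2 z * f1 z)"
  have c1: "continuous_on UNIV f1" "continuous_on UNIV f2"
    unfolding f1_def f2_def by (intro continuous_intros continuous_on_compose2 [OF e(1)]; auto)+
  have c2: "continuous_on UNIV g1" "continuous_on UNIV g2"
    unfolding g1_def g2_def by (intro continuous_intros)+
  have c3: "continuous_on UNIV F" "continuous_on UNIV G"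
    unfolding F_def G_def using c1 c2 by (auto intro!: continuous_intros)
  have out1: "g1 z = 0" "g2 z = 0" if "norm z \<ge> r" for z
    using norm_triangle_ineq2 [of z a] norm_diff_ineq [of z a] that a by (auto simp: g1_def g2_def)
  have lower: "g1 z = 0 \<and> f1 z \<noteq> 0" if "Im z \<le> 0" for z
  proof -
    have "norm (z - a) \<ge> r / 2"
      using abs_Im_le_cmod [of "z - a"] that r by (simp add: a_def)
    then show ?thesis using r e(2) [of "z - a"] by (auto simp: g1_def f1_def)
  qed
  have upper: "g2 z = 0 \<and> f2 z \<noteq> 0" if "Im z \<ge> 0" for z
  proof -
    have "norm (z + a) \<ge> r / 2"
      using abs_Im_le_cmod [of "z + a"] that r by (simp add: a_def)
    then show ?thesis using r e(2) [of "z + a"] by (auto simp: g2_def f2_def)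
  qed
  have nz1: "f1 z \<noteq> 0 \<or> g1 z \<noteq> 0" for z
    using e(2) [of "z - a"] r by (auto simp: f1_def g1_def)
  have nz2: "f2 z \<noteq> 0 \<or> g2 z \<noteq> 0" for z
    using e(2) [of "z + a"] r by (auto simp: f2_def g2_def)
  have nzF: "F z \<noteq> 0 \<or> G z \<noteq> 0" for z
    using nz1 [of z] nz2 [of z] lower [of z] upper [of z] by (cases "Im z \<ge> 0") (auto simp: F_def G_def)
  have pos: "f1 z \<noteq> 0" "f2 z \<noteq> 0" if "norm z = r" for z
    using out1 [of z] nz1 nz2 that by (metis order_refl)+
  have w1: "winding_number (\<lambda>t. f1 (of_real r * cis (2 * pi * t))) 0 = of_int s"
    unfolding f1_def using we [of a] a r by simp
  have w2': "winding_number (\<lambda>t. e (of_real r * cis (2 * pi * t) + a)) 0 = of_int s"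
    using we [of "-a"] a r by simp
  have w2: "winding_number (\<lambda>t. f2 (of_real r * cis (2 * pi * t))) 0 = of_int (int n * s)"
    unfolding f2_def
  proof (subst winding_number_power)
    show "path (\<lambda>t. e (of_real r * cis (2 * pi * t) + a))"
      unfolding path_def by (intro continuous_on_compose2 [OF e(1)] continuous_intros) auto
    show "0 \<notin> path_image (\<lambda>t. e (of_real r * cis (2 * pi * t) + a))"
    proof -
      have "of_real r * cis (2 * pi * t) + a \<noteq> 0" for t
        using norm_diff_ineq [of "of_real r * cis (2 * pi * t)" a] a r by (auto simp: norm_mult)
      then show ?thesis using e(2) by (auto simp: path_image_def)
    qed
  qed (simp add: w2')
  have wF: "winding_number (\<lambda>t. F (of_real r * cis (2 * pi * t))) 0 = of_int (int (Suc n) * s)"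
    unfolding F_def using path_circle_comp [OF c1(1)] path_circle_comp [OF c1(2)] pos r w1 w2
    by (subst winding_number_mult) (auto simp: path_image_def norm_mult algebra_simps)
  have "Brouwer_degree2 2 (pair_map f g) = Brouwer_degree2 2 (pair_map F G)"
    by (rule Brouwer_degree2_pair_map_cong [OF Suc.prems(1-3) c3 nzF r Suc.prems(4)])
       (use out1 wF Suc.prems(5) in \<open>auto simp: G_def\<close>)
  also have "\<dots> = Brouwer_degree2 2 (pair_map f1 g1) + Brouwer_degree2 2 (pair_map f2 g2)"
  \<comment> \<open>Coordinate 1 of a point other than the pole has the sign of the imaginary part
    of its stereographic coordinate, so the hemispheres for \<open>k = 1\<close> are the two
    half-planes.\<close>
  proof (rule Brouwer_degree2_add [where k = 1 and c = north_pole])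
    have im: "Im (stereo_coord x) = x 1 / (1 - x 2)" for x
      by (simp add: stereo_coord_def)
    show "pair_map f1 g1 x = pair_map F G x \<and> pair_map f2 g2 x = north_pole"
      if x: "x \<in> topspace (nsphere 2)" "x 1 \<ge> 0" for x
    proof -
      have "Im (stereo_coord x) \<ge> 0" using x nsphere_2_bounds [OF x(1)] by (simp add: im)
      then show ?thesis
        using upper [of "stereo_coord x"] hopf_scale [of "f2 (stereo_coord x)" "f1 (stereo_coord x)" "g1 (stereo_coord x)"]
        by (simp add: pair_map_def extend_infinity_def F_def G_def hopf_0_right mult.commute)
    qed
    show "pair_map f1 g1 x = north_pole \<and> pair_map f2 g2 x = pair_map F G x"
      if x: "x \<in> topspace (nsphere 2)" "x 1 \<le> 0" for x
    proof -
      have "Im (stereo_coord x) \<le> 0"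
        using x nsphere_2_bounds [OF x(1)] by (simp add: im divide_nonpos_nonneg)
      then show ?thesis
        using lower [of "stereo_coord x"] hopf_scale [of "f1 (stereo_coord x)" "f2 (stereo_coord x)" "g2 (stereo_coord x)"]
        by (simp add: pair_map_def extend_infinity_def F_def G_def hopf_0_right mult.commute)
    qed
    show "continuous_map (nsphere 2) (nsphere 2) (pair_map F G)"
      by (rule continuous_map_pair_map [OF c3 nzF r]) (simp add: G_def out1)
  qed (auto intro!: continuous_map_pair_map [OF _ _ _ r] c1 c2 out1 nz1 nz2 simp: nz1 nz2)
  also have "Brouwer_degree2 2 (pair_map f1 g1) = s"
    by (rule one [OF c1(1) c2(1) nz1 out1(1) w1])
  also have "Brouwer_degree2 2 (pair_map f2 g2) = int n * s"
    by (rule Suc.IH [OF c1(2) c2(2) nz2 out1(2) w2])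
  finally show ?case by (simp add: algebra_simps)
qed

text \<open>The winding number is an integer m. Multiples of the identity cover m \<ge> 0 and
  multiples of a reflection cover m < 0.\<close>

theorem Brouwer_degree2_pair_map:
  assumes f: "continuous_on UNIV f" and g: "continuous_on UNIV g" and nz: "\<And>z. f z \<noteq> 0 \<or> g z \<noteq> 0"
    and r: "r > 0" and out: "\<And>z. norm z \<ge> r \<Longrightarrow> g z = 0"
  shows "of_int (Brouwer_degree2 2 (pair_map f g)) = winding_number (\<lambda>t. f (of_real r * cis (2 * pi * t))) 0"
proof -
  let ?w = "\<lambda>f. winding_number (\<lambda>t. f (of_real r * cis (2 * pi * t))) 0"
  have "f z \<noteq> 0" if "norm z = r" for z
    using nz out that by (metis order_refl)
  then have "?w f \<in> \<int>"
    using path_circle_comp [OF f] r by (intro integer_winding_number) (auto simp: path_image_def norm_mult)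
  then obtain m where m: "?w f = of_int m"
    by (auto elim: Ints_cases)
  have shift: "winding_number (\<lambda>t. of_real r * cis (2 * pi * t) - a) 0 = 1" if "norm a < r" for a
    using winding_number_shifted_circle [OF r, of a] that by simp
  \<comment> \<open>The minus sign makes the model z \<mapsto> - conj z the reflection in coordinate
    0; conjugation alone would reflect coordinate 1.\<close>
  have shift': "winding_number (\<lambda>t. - cnj (of_real r * cis (2 * pi * t) - a)) 0 = -1" if "norm a < r" for a
  proof -
    let ?p = "\<lambda>t. of_real r * cis (2 * pi * t) - a"
    have p: "path ?p" by (auto simp: path_def intro!: continuous_intros)
    have p0: "0 \<notin> path_image ?p" using that r by (auto simp: path_image_def norm_mult)
    have "winding_number (\<lambda>t. -1 * (cnj \<circ> ?p) t) 0 = winding_number (cnj \<circ> ?p) 0"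
    proof (rule winding_number_cmult)
      show "path (cnj \<circ> ?p)"
        using p by (auto simp: path_def intro!: continuous_intros)
      show "0 \<notin> path_image (cnj \<circ> ?p)"
        using p0 by (force simp: path_image_compose)
    qed auto
    also have "\<dots> = -1"
      using winding_number_cnj [OF p p0] shift [OF that] by simp
    finally show ?thesis by (simp add: o_def)
  qed
  have deg_id: "Brouwer_degree2 2 (pair_map f g) = 1"
    if "continuous_on UNIV f" "continuous_on UNIV g" "\<And>z. f z \<noteq> 0 \<or> g z \<noteq> 0"
        "\<And>z. norm z \<ge> r \<Longrightarrow> g z = 0" "?w f = of_int 1" for f g
    using that shift [of 0] r
    by (subst Brouwer_degree2_pair_map_of_model [of id "\<lambda>z. z" r])
       (auto simp: hopf_stereo_coord north_pole_def)
  have deg_refl: "Brouwer_degree2 2 (pair_map f g) = -1"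
    if fg: "continuous_on UNIV f" "continuous_on UNIV g" "\<And>z. f z \<noteq> 0 \<or> g z \<noteq> 0"
        "\<And>z. norm z \<ge> r \<Longrightarrow> g z = 0" "?w f = of_int (-1)" for f g
  proof -
    have "Brouwer_degree2 2 (pair_map f g) = Brouwer_degree2 2 (\<lambda>x i. if i = 0 then - x i else x i)"
    proof (rule Brouwer_degree2_pair_map_of_model [of _ "\<lambda>z. - cnj z" r])
      show "continuous_map (nsphere 2) (nsphere 2) (\<lambda>x i. if i = 0 then - x i else x i)"
        by (rule continuous_map_nsphere_reflection)
      show "(\<lambda>i. if i = 0 then - x i else x i) = hopf (- cnj (stereo_coord x)) 1"
        if "x \<in> topspace (nsphere 2)" "x 2 \<noteq> 1" for x
      proof -
        have "hopf (- cnj z) 1 = (\<lambda>i. if i = 0 then - hopf z 1 i else hopf z 1 i)" for z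
          by (auto simp: hopf_def)
        then show ?thesis by (simp only: hopf_stereo_coord [OF that])
      qed
    qed (use fg r shift' [of 0] in \<open>auto simp: north_pole_def intro!: continuous_intros\<close>)
    then show ?thesis by (simp add: Brouwer_degree2_reflection)
  qed
  have "Brouwer_degree2 2 (pair_map f g) = m"
  proof (cases "m \<ge> 0")
    case True
    have "Brouwer_degree2 2 (pair_map f g) = int (nat m) * 1"
      by (rule Brouwer_degree2_pair_map_multiple [of r "\<lambda>z. z", OF r _ _ _ deg_id f g nz out])
         (use shift m True in auto)
    then show ?thesis using True by simp
  next
    case False
    have "Brouwer_degree2 2 (pair_map f g) = int (nat (- m)) * (-1)"
      by (rule Brouwer_degree2_pair_map_multiple [of r "\<lambda>z. - cnj z", OF r _ _ _ deg_refl f g nz out])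
         (use shift' m False in \<open>auto intro!: continuous_intros\<close>)
    then show ?thesis using False by simp
  qed
  then show ?thesis by (simp add: m)
qed

subsection \<open>Polynomials in z and its conjugate\<close>

lemma zzeval_superset:
  assumes "finite A" "{(a, b). c a b \<noteq> 0} \<subseteq> A"
  shows "zzeval c z = (\<Sum>(a, b)\<in>A. c a b * z ^ a * cnj z ^ b)"
  unfolding zzeval_def using assms by (intro sum.mono_neutral_left) auto

lemma continuous_on_zzeval: "continuous_on S (zzeval c)"
  unfolding zzeval_def case_prod_unfold by (intro continuous_intros)

lemma le_zzdeg:
  assumes "zzpoly c" "c a b \<noteq> 0" shows "a + b \<le> zzdeg c"
proof -
  have "{a + b | a b. c a b \<noteq> 0} = (\<lambda>(a, b). a + b) ` {(a, b). c a b \<noteq> 0}" by auto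
  then have "finite {a + b | a b. c a b \<noteq> 0}"
    using assms(1) by (simp add: zzpoly_def)
  then show ?thesis
    unfolding zzdeg_def using assms(2) by (intro Max_ge) auto
qed

lemma zzdeg_attained:
  assumes "zzpoly c" "c \<noteq> (\<lambda>a b. 0)"
  obtains a b where "c a b \<noteq> 0" "a + b = zzdeg c"
proof -
  let ?D = "{a + b | a b. c a b \<noteq> 0}"
  have "?D = (\<lambda>(a, b). a + b) ` {(a, b). c a b \<noteq> 0}" by auto
  then have fin: "finite ?D"
    using assms(1) by (simp add: zzpoly_def)
  obtain a b where ab: "c a b \<noteq> 0" using assms(2) by blast
  have "zzdeg c \<in> insert 0 ?D"
    unfolding zzdeg_def using fin by (intro Max_in) auto
  then show thesis
    using that le_zzdeg [OF assms(1) ab] ab by force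
qed

lemma zzpoly_if: "zzpoly c \<Longrightarrow> zzpoly (\<lambda>a b. if P a b then c a b else 0)"
  unfolding zzpoly_def by (erule finite_subset [rotated]) auto

lemma zzpoly_zzhom: "zzpoly c \<Longrightarrow> zzpoly (zzhom d c)"
  using zzpoly_if [of c "\<lambda>a b. a + b = d"] by (simp add: zzhom_def [abs_def])

lemma zzeval_split_top:
  assumes "zzpoly c"
  shows "zzeval c z = zzeval (zzhom d c) z + zzeval (\<lambda>a b. if a + b \<noteq> d then c a b else 0) z"
proof -
  let ?A = "{(a, b). c a b \<noteq> 0}"
  have fin: "finite ?A" using assms by (simp add: zzpoly_def)
  show ?thesis
    using fin
    by (subst (1 2 3) zzeval_superset [of ?A])
       (auto simp: zzhom_def sum.distrib [symmetric] intro!: sum.cong)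
qed

text \<open>The number \<open>k\<close> is the gap between the degree of \<open>c\<close> and
  \<open>d\<close>. Keeping its power on the left avoids a truncated difference of
  exponents.\<close>

lemma zzeval_growth:
  assumes "zzpoly c" and deg: "\<And>a b. c a b \<noteq> 0 \<Longrightarrow> a + b + k \<le> d"
  obtains C where "C \<ge> 0" "\<And>z. norm z \<ge> 1 \<Longrightarrow> norm (zzeval c z) * norm z ^ k \<le> C * norm z ^ d"
proof
  let ?A = "{(a, b). c a b \<noteq> 0}"
  let ?C = "\<Sum>(a, b)\<in>?A. norm (c a b)"
  show "?C \<ge> 0" by (intro sum_nonneg) auto
  fix z :: complex assume z: "norm z \<ge> 1"
  have "norm (zzeval c z) \<le> (\<Sum>(a, b)\<in>?A. norm (c a b) * norm z ^ (a + b))"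
    unfolding zzeval_def
    by (rule order_trans [OF norm_sum])
       (auto intro!: sum_mono simp: norm_mult norm_power power_add mult.assoc)
  then have "norm (zzeval c z) * norm z ^ k \<le> (\<Sum>(a, b)\<in>?A. norm (c a b) * norm z ^ (a + b)) * norm z ^ k"
    by (rule mult_right_mono) simp
  also have "\<dots> = (\<Sum>(a, b)\<in>?A. norm (c a b) * norm z ^ (a + b + k))"
    by (simp add: sum_distrib_right power_add case_prod_unfold mult.assoc)
  also have "\<dots> \<le> (\<Sum>(a, b)\<in>?A. norm (c a b) * norm z ^ d)"
    using deg z by (auto intro!: sum_mono mult_left_mono power_increasing)
  also have "\<dots> = ?C * norm z ^ d"
    by (simp add: sum_distrib_right case_prod_unfold)
  finally show "norm (zzeval c z) * norm z ^ k \<le> ?C * norm z ^ d" .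
qed

section \<open>Homogeneous polynomials on rays and on the unit circle\<close>

lemma zzeval_zzhom_scale:
  "zzeval (zzhom d c) (of_real s * z) = of_real s ^ d * zzeval (zzhom d c) z"
  unfolding zzeval_def sum_distrib_left
proof (intro sum.cong refl, clarify)
  fix a b assume "zzhom d c a b \<noteq> 0"
  then have "d = a + b" by (auto simp: zzhom_def split: if_splits)
  then show "zzhom d c a b * (of_real s * z) ^ a * cnj (of_real s * z) ^ b =
        of_real s ^ d * (zzhom d c a b * z ^ a * cnj z ^ b)"
    by (simp add: power_mult_distrib power_add mult_ac)
qed

text \<open>On the unit circle the conjugate of u is its inverse. Since a + b = d, the exponent
  \<open>d + a - b\<close> equals 2 a, so its subtraction never truncates.\<close>

lemma poly_zztilde:
  assumes u: "norm u = 1"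
  shows "poly (zztilde d (zzhom d c)) u = u ^ d * zzeval (zzhom d c) u"
  unfolding zztilde_def zzeval_def sum_distrib_left poly_sum case_prod_unfold
proof (rule sum.cong [OF refl])
  fix p assume "p \<in> {p. zzhom d c (fst p) (snd p) \<noteq> 0}"
  moreover obtain a b where p: "p = (a, b)" by force
  ultimately have d: "d = a + b" by (auto simp: zzhom_def split: if_splits)
  have "u * cnj u = 1" using u by (simp add: complex_norm_square [symmetric])
  then have 1: "u ^ b * cnj u ^ b = 1" by (metis power_mult_distrib power_one)
  have "u ^ d * (zzhom d c a b * u ^ a * cnj u ^ b) = zzhom d c a b * u ^ (a + a) * (u ^ b * cnj u ^ b)"
    by (simp add: d power_add mult_ac)
  also have "\<dots> = zzhom d c a b * u ^ (d + a - b)"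
    unfolding 1 by (simp add: d)
  finally show "poly (monom (zzhom d c (fst p) (snd p)) (d + fst p - snd p)) u
      = u ^ d * (zzhom d c (fst p) (snd p) * u ^ fst p * cnj u ^ snd p)"
    by (simp only: p fst_conv snd_conv poly_monom)
qed

text \<open>The monomial with exponents a and b goes to degree 2 a, so distinct monomials of total
  degree d cannot cancel.\<close>

lemma zztilde_nonzero:
  assumes "zzpoly c" "c a b \<noteq> 0" "a + b = d"
  shows "zztilde d (zzhom d c) \<noteq> 0"
proof -
  let ?A = "{(a, b). zzhom d c a b \<noteq> 0}"
  have fin: "finite ?A" using zzpoly_zzhom [OF assms(1)] by (simp add: zzpoly_def)
  have "coeff (zztilde d (zzhom d c)) (2 * a) = (\<Sum>p\<in>?A. if p = (a, b) then zzhom d c a b else 0)"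
    unfolding zztilde_def coeff_sum
    by (intro sum.cong refl) (use assms(3) in \<open>auto simp: zzhom_def split: if_splits\<close>)
  also have "\<dots> = zzhom d c a b"
    using fin assms by (simp add: zzhom_def)
  finally show ?thesis using assms by (auto simp: zzhom_def)
qed

text \<open>T is a constant times s^d on the ray of parameter s. A zero v on the circle rules out an
  infinite limit and forces a finite limit to be 0, hence T = 0 on every ray.\<close>
lemma zzhom_nonzero_on_circle:
  assumes c: "zzpoly c" "c a b \<noteq> 0" "a + b = d"
    and lim: "(\<exists>L. (zzeval (zzhom d c) \<longlongrightarrow> L) at_infinity)
         \<or> filterlim (\<lambda>z. norm (zzeval (zzhom d c) z)) at_top at_infinity"
    and v: "norm v = 1"
  shows "zzeval (zzhom d c) v \<noteq> 0"
proof
  let ?T = "zzeval (zzhom d c)"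
  assume 0: "?T v = 0"
  have ray: "filterlim (\<lambda>s::real. of_real s * w) at_infinity at_top" if "norm w = 1" for w :: complex
  proof (rule filterlim_norm_at_top_imp_at_infinity)
    have "\<forall>\<^sub>F s::real in at_top. s = norm (of_real s * w)"
      using eventually_ge_at_top [of "0::real"] by eventually_elim (simp add: norm_mult that)
    then show "filterlim (\<lambda>s::real. norm (of_real s * w)) at_top at_top"
      using filterlim_cong [OF refl refl, of "\<lambda>s. s" "\<lambda>s::real. norm (of_real s * w)"] filterlim_ident by blast
  qed
  have Tv: "?T (of_real s * v) = 0" for s
    by (simp add: zzeval_zzhom_scale 0)
  from lim show False
  proof
    assume "filterlim (\<lambda>z. norm (?T z)) at_top at_infinity"
    then have "filterlim (\<lambda>s::real. norm (?T (of_real s * v))) at_top at_top"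
      by (rule filterlim_compose [OF _ ray [OF v]])
    then have "filterlim (\<lambda>s::real. 0::real) at_top at_top" by (simp add: Tv)
    then have "\<forall>Z::real. Z < 0" by (simp add: filterlim_at_top_dense)
    then show False by (metis less_irrefl)
  next
    assume "\<exists>L. (?T \<longlongrightarrow> L) at_infinity"
    then obtain L where L: "(?T \<longlongrightarrow> L) at_infinity" by blast
    have "((\<lambda>s::real. ?T (of_real s * v)) \<longlongrightarrow> L) at_top"
      by (rule filterlim_compose [OF L ray [OF v]])
    then have "L = 0" by (simp add: Tv tendsto_const_iff)
    have all: "?T u = 0" if u: "norm u = 1" for u
    proof -
      have "((\<lambda>s::real. norm (?T (of_real s * u))) \<longlongrightarrow> 0) at_top"
        using tendsto_norm [OF filterlim_compose [OF L ray [OF u]]] \<open>L = 0\<close> by simp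
      moreover have "\<forall>\<^sub>F s::real in at_top. norm (?T u) \<le> norm (?T (of_real s * u))"
        using eventually_ge_at_top [of "1::real"]
      proof eventually_elim
        case (elim s)
        then have "1 * norm (?T u) \<le> s ^ d * norm (?T u)"
          by (intro mult_right_mono one_le_power) auto
        then show ?case using elim by (simp add: zzeval_zzhom_scale norm_mult norm_power)
      qed
      ultimately have "norm (?T u) \<le> 0"
        by (rule tendsto_lowerbound) simp
      then show ?thesis by simp
    qed
    \<comment> \<open>Vanishing on the whole circle gives a nonzero polynomial in one variable
      infinitely many roots.\<close>
    have "sphere 0 1 \<subseteq> {u. poly (zztilde d (zzhom d c)) u = 0}"
      by (auto simp: poly_zztilde all)
    moreover have "finite {u. poly (zztilde d (zzhom d c)) u = 0}"
      using zztilde_nonzero [OF c] by (rule poly_roots_finite)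
    moreover have "infinite (sphere (0::complex) 1)"
    proof
      assume "finite (sphere (0::complex) 1)"
      moreover have "connected (sphere (0::complex) 1)" by (rule connected_sphere) simp
      ultimately obtain x where "sphere (0::complex) 1 = {x}"
        using connected_finite_iff_sing [of "sphere (0::complex) 1"] by auto
      moreover have "1 \<in> sphere (0::complex) 1" "- 1 \<in> sphere (0::complex) 1" by auto
      ultimately show False by (metis one_neq_neg_one singletonD)
    qed
    ultimately show False using finite_subset by blast
  qed
qed

section \<open>The rational map in coordinates and its value at infinity\<close>

lemma sphmap_ratmap:
  assumes "x 2 \<noteq> 1" "\<not> (zzeval f (stereo_coord x) = 0 \<and> zzeval g (stereo_coord x) = 0)"
  shows "sphmap (ratmap f g rho) x = hopf (zzeval f (stereo_coord x)) (zzeval g (stereo_coord x))"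
proof (cases "zzeval g (stereo_coord x) = 0")
  case True
  then have "hopf (zzeval f (stereo_coord x)) (zzeval g (stereo_coord x)) = north_pole"
    using assms by (simp add: hopf_0_right)
  with True assms(1) show ?thesis
    by (simp add: sphmap_def ratmap_def unstereo_def stereo_coord_def stereo_def north_pole_def)
next
  case False
  with assms(1) show ?thesis
    by (simp add: hopf_eq_stereo) (simp add: sphmap_def ratmap_def unstereo_def stereo_coord_def)
qed

lemma stereo_coord_hopf: "stereo_coord (hopf z 1) = z"
proof -
  have n: "(norm z)\<^sup>2 + 1 > 0" by (simp add: add_nonneg_pos)
  then have "1 - ((norm z)\<^sup>2 - 1) / ((norm z)\<^sup>2 + 1) = 2 / ((norm z)\<^sup>2 + 1)"
    by (simp add: field_simps)
  then show ?thesis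
    using n by (simp add: stereo_coord_def hopf_def complex_eq_iff)
qed

text \<open>The height grows with the ratio of norm u to norm v. Homogeneous notation includes the
  case v = 0.\<close>

lemma hopf_2_lower_bound:
  assumes "A > 0" "A \<le> norm u" "norm v \<le> B"
  shows "(A\<^sup>2 - B\<^sup>2) / (A\<^sup>2 + B\<^sup>2) \<le> hopf u v 2"
proof -
  have A: "A\<^sup>2 > 0" "A\<^sup>2 \<le> (norm u)\<^sup>2" "(norm v)\<^sup>2 \<le> B\<^sup>2"
    using assms by (auto intro!: power_mono)
  then have "A\<^sup>2 * (norm v)\<^sup>2 \<le> (norm u)\<^sup>2 * B\<^sup>2"
    by (intro mult_mono) auto
  moreover have "A\<^sup>2 + B\<^sup>2 > 0" "(norm u)\<^sup>2 + (norm v)\<^sup>2 > 0"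
    using A by (auto intro!: add_pos_nonneg)
  ultimately show ?thesis
    by (simp add: hopf_def divide_le_eq le_divide_eq) (simp add: field_simps)
qed

text \<open>The value at infinity is a limit of values along the positive real ray, and the uniform
  bound on their heights passes to the limit.\<close>

lemma north_value_not_south:
  assumes R: "continuous_map (nsphere 2) (nsphere 2) R"
    and eq: "\<And>x. \<lbrakk>x \<in> topspace (nsphere 2); x 2 \<noteq> 1\<rbrakk> \<Longrightarrow> R x = hopf (f (stereo_coord x)) (g (stereo_coord x))"
    and b: "\<beta> > -1" "r > 0" "\<And>z. norm z \<ge> r \<Longrightarrow> \<beta> \<le> hopf (f z) (g z) 2"
  shows "R north_pole 2 \<noteq> -1"
proof -
  let ?S = "topspace (nsphere 2)"
  \<comment> \<open>The points [1 : t] run along the ray z = 1 / t and reach infinity at t =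
    0.\<close>
  define \<phi> where "\<phi> = (\<lambda>t::real. R (hopf 1 (of_real t)) 2)"
  have "continuous_on UNIV (\<lambda>t::real. R (hopf 1 (of_real t)))"
  proof (rule continuous_on_compose2 [of ?S R])
    show "continuous_on ?S R" using R by (simp add: continuous_map_nsphere_iff)
    show "continuous_on UNIV (\<lambda>t::real. hopf 1 (of_real t))"
      by (rule continuous_on_hopf) (auto intro!: continuous_intros)
  qed (auto simp: hopf_in_nsphere)
  then have "continuous_on UNIV \<phi>"
    unfolding \<phi>_def by (rule continuous_on_product_then_coordinatewise)
  then have "isCont \<phi> 0"
    by (simp add: continuous_on_eq_continuous_at)
  then have "(\<phi> \<longlongrightarrow> \<phi> 0) (at_right 0)"
    by (simp add: isCont_def filterlim_at_split)
  moreover have "\<forall>\<^sub>F t in at_right 0. \<beta> \<le> \<phi> t"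
  proof -
    have "\<beta> \<le> \<phi> t" if t: "0 < t" "t < 1 / r" for t
    proof -
      have "hopf 1 (of_real t) = hopf (of_real t * of_real (1 / t)) (of_real t * 1)"
        using t by simp
      also have "\<dots> = hopf (of_real (1 / t)) 1"
        using t by (intro hopf_scale) simp
      finally have h: "hopf 1 (of_real t) = hopf (of_real (1 / t)) 1" .
      have "hopf (of_real (1 / t)) 1 2 \<noteq> 1"
        using height_less_1 [of "norm (complex_of_real (1 / t))"] by (simp add: hopf_def)
      then have "\<phi> t = hopf (f (of_real (1 / t))) (g (of_real (1 / t))) 2"
        unfolding \<phi>_def h by (subst eq) (simp_all add: hopf_in_nsphere stereo_coord_hopf)
      moreover have "norm (complex_of_real (1 / t)) \<ge> r"
        using t b(2) by (simp add: norm_divide field_simps)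
      ultimately show ?thesis using b(3) by metis
    qed
    moreover have "0 < 1 / r" using b by simp
    ultimately show ?thesis
      unfolding eventually_at_right_field by blast
  qed
  ultimately have "\<beta> \<le> \<phi> 0"
    by (rule tendsto_lowerbound) simp
  then show ?thesis
    using b(1) by (simp add: \<phi>_def hopf_0_right)
qed

theorem theorem2:
  fixes f g :: "nat \<Rightarrow> nat \<Rightarrow> complex" and rho :: "complex option"
  assumes "zzpoly f" and "zzpoly g"
    and "f \<noteq> (\<lambda>a b. 0)"
    and "\<forall>z. \<not> (zzeval f z = 0 \<and> zzeval g z = 0)"
    and "zzdeg g \<le> zzdeg f"
    and "(\<exists>L. (zzeval (zzhom (zzdeg f) f) \<longlongrightarrow> L) at_infinity)
         \<or> filterlim (\<lambda>z. norm (zzeval (zzhom (zzdeg f) f) z)) at_top at_infinity"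
    and "continuous_map (nsphere 2) (nsphere 2) (sphmap (ratmap f g rho))"
  shows "Brouwer_degree2 2 (sphmap (ratmap f g rho))
           = int (\<Sum>z \<in> {z. poly (zztilde (zzdeg f) (zzhom (zzdeg f) f)) z = 0 \<and> norm z < 1}.
                    order z (zztilde (zzdeg f) (zzhom (zzdeg f) f)))
             - int (zzdeg f)
       \<and> winding_number (\<lambda>t. zzeval (zzhom (zzdeg f) f) (cis (2 * pi * t))) 0
           = of_int (Brouwer_degree2 2 (sphmap (ratmap f g rho)))"
proof -
  define d where "d = zzdeg f"
  define T where "T = zzeval (zzhom d f)"
  define P where "P = zztilde d (zzhom d f)"
  define R where "R = sphmap (ratmap f g rho)"
  define N where "N = (\<Sum>z \<in> {z. poly P z = 0 \<and> norm z < 1}. order z P)"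
  let ?F = "zzeval f" and ?G = "zzeval g"
  obtain a b where ab: "f a b \<noteq> 0" "a + b = d"
    using zzdeg_attained [OF assms(1,3)] unfolding d_def by blast
  have nz: "?F z \<noteq> 0 \<or> ?G z \<noteq> 0" for z using assms(4) by blast
  have T_nz: "T u \<noteq> 0" if "norm u = 1" for u
    unfolding T_def using zzhom_nonzero_on_circle [OF assms(1) ab _ that] assms(6) by (simp add: d_def)
  have contT: "continuous_on A T" for A
    unfolding T_def by (rule continuous_on_zzeval)
  \<comment> \<open>Compactness turns the absence of zeros on the circle into a positive lower bound
    \<open>m\<close>, which homogeneity spreads to the plane as \<open>T_lower\<close>.\<close>
  obtain u0 where "norm u0 = 1" and "\<And>u. norm u = 1 \<Longrightarrow> norm (T u0) \<le> norm (T u)"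
  proof -
    have "continuous_on (sphere 0 1) (\<lambda>u. norm (T u))"
      by (intro continuous_intros contT)
    then show thesis
      using continuous_attains_inf [of "sphere (0::complex) 1" "\<lambda>u. norm (T u)"] that by auto
  qed
  then obtain m where m: "m > 0" "\<And>u. norm u = 1 \<Longrightarrow> m \<le> norm (T u)"
    using T_nz by (metis zero_less_norm_iff)
  have T_scale: "T (of_real s * z) = of_real s ^ d * T z" for s z
    by (simp add: T_def zzeval_zzhom_scale)
  have T_lower: "m * norm z ^ d \<le> norm (T z)" if "z \<noteq> 0" for z
  proof -
    have "z = of_real (norm z) * sgn z" using that by (simp add: sgn_eq)
    then have "norm (T z) = norm z ^ d * norm (T (sgn z))"
      using T_scale [of "norm z" "sgn z"] by (simp add: norm_mult norm_power)
    moreover have "m \<le> norm (T (sgn z))" using that by (intro m) (simp add: norm_sgn)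
    ultimately show ?thesis
      using mult_left_mono [of m "norm (T (sgn z))" "norm z ^ d"] by (simp add: mult.commute)
  qed
  \<comment> \<open>The terms of f below the top have degree at most d - 1, hence the gap 1.\<close>
  obtain C where C: "C \<ge> 0" "\<And>z. norm z \<ge> 1 \<Longrightarrow> norm (?F z - T z) * norm z \<le> C * norm z ^ d"
  proof (rule zzeval_growth [of "\<lambda>a b. if a + b \<noteq> d then f a b else 0" 1 d])
    show "zzpoly (\<lambda>a b. if a + b \<noteq> d then f a b else 0)"
      using assms(1) by (rule zzpoly_if)
    show "a + b + 1 \<le> d" if "(if a + b \<noteq> d then f a b else 0) \<noteq> 0" for a b
      using that le_zzdeg [OF assms(1), of a b] by (simp add: d_def split: if_splits)
  qed (auto simp: T_def zzeval_split_top [OF assms(1), of _ d])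
  \<comment> \<open>Gap 0: this is where deg g \<le> deg f enters.\<close>
  obtain B where B: "B \<ge> 0" "\<And>z. norm z \<ge> 1 \<Longrightarrow> norm (?G z) \<le> B * norm z ^ d"
  proof (rule zzeval_growth [of g 0 d])
    show "a + b + 0 \<le> d" if "g a b \<noteq> 0" for a b
      using le_zzdeg [OF assms(2) that] assms(5) by (simp add: d_def)
  qed (use assms(2) in auto)
  \<comment> \<open>Beyond this radius the lower terms of f are at most half of the bound m |z|^d
    for T.\<close>
  define r where "r = max 1 (2 * C / m)"
  have r: "r \<ge> 1" "r > 0" by (auto simp: r_def)
  have near: "norm (?F z - T z) \<le> m / 2 * norm z ^ d" if z: "norm z \<ge> r" for z
  proof -
    have "2 * C / m \<le> norm z" using z by (simp add: r_def)
    then have "C \<le> m / 2 * norm z" using m(1) by (simp add: field_simps)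
    then have "C * norm z ^ d \<le> m / 2 * norm z * norm z ^ d" by (rule mult_right_mono) simp
    then have "norm (?F z - T z) * norm z \<le> (m / 2 * norm z ^ d) * norm z"
      using C(2) [of z] z r by (simp add: mult_ac)
    moreover have "norm z > 0" using z r by linarith
    ultimately show ?thesis by (rule mult_right_le_imp_le)
  qed
  have F_lower: "m / 2 * norm z ^ d \<le> norm (?F z)" if z: "norm z \<ge> r" for z
  proof -
    have "z \<noteq> 0" using z r by auto
    then show ?thesis
      using near [OF z] T_lower [of z] norm_triangle_ineq2 [of "T z" "?F z"] by (simp add: norm_minus_commute)
  qed
  have F_nz: "?F z \<noteq> 0" if z: "norm z \<ge> r" for z
  proof -
    have "m / 2 * norm z ^ d > 0" using m z r by (intro mult_pos_pos zero_less_power) auto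
    then show ?thesis using F_lower [OF z] by auto
  qed
  have R: "continuous_map (nsphere 2) (nsphere 2) R" using assms(7) by (simp add: R_def)
  have R_eq: "R x = hopf (?F (stereo_coord x)) (?G (stereo_coord x))" if "x 2 \<noteq> 1" for x
    unfolding R_def using that assms(4) by (intro sphmap_ratmap) auto
  have bound: "((m / 2)\<^sup>2 - B\<^sup>2) / ((m / 2)\<^sup>2 + B\<^sup>2) \<le> hopf (?F z) (?G z) 2" if z: "norm z \<ge> r" for z
  proof -
    have p: "norm z ^ d > 0" using z r by (intro zero_less_power) auto
    \<comment> \<open>Dividing both coordinates by |z|^d leaves the point unchanged and makes the
      bounds on f and g independent of z.\<close>
    define q where "q = complex_of_real (norm z ^ d)"
    have "norm q = norm z ^ d" by (simp add: q_def norm_power)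
    with p have q: "q \<noteq> 0" "norm q = norm z ^ d" by (metis norm_zero less_irrefl)+
    have "((m / 2)\<^sup>2 - B\<^sup>2) / ((m / 2)\<^sup>2 + B\<^sup>2) \<le> hopf (?F z / q) (?G z / q) 2"
    proof (rule hopf_2_lower_bound)
      show "m / 2 \<le> norm (?F z / q)"
        using F_lower [OF z] p q by (simp add: norm_divide le_divide_eq)
      show "norm (?G z / q) \<le> B"
        using B(2) [of z] z r p q by (simp add: norm_divide divide_le_eq)
    qed (use m in auto)
    also have "hopf (?F z / q) (?G z / q) = hopf (?F z) (?G z)"
      using hopf_scale [OF q(1), of "?F z / q" "?G z / q"] q(1) by simp
    finally show ?thesis .
  qed
  have "-1 < ((m / 2)\<^sup>2 - B\<^sup>2) / ((m / 2)\<^sup>2 + B\<^sup>2)"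
  proof -
    have "(m / 2)\<^sup>2 > 0" using m by simp
    moreover have "(m / 2)\<^sup>2 + B\<^sup>2 > 0" using calculation by (intro add_pos_nonneg) auto
    ultimately show ?thesis by (subst pos_less_divide_eq) auto
  qed
  then have north: "R north_pole 2 \<noteq> -1"
    using R R_eq r(2) bound by (intro north_value_not_south [of R ?F ?G]) auto
  obtain c where c: "continuous_on UNIV c" "\<And>z. norm z \<ge> r \<Longrightarrow> c z = 0" "\<And>z. norm z < r \<Longrightarrow> c z \<noteq> 0"
    and degR: "Brouwer_degree2 2 R = Brouwer_degree2 2 (pair_map ?F (\<lambda>z. complex_of_real (c z) * ?G z))"
    by (rule Brouwer_degree2_pair_map_cutoff [OF R _ nz r(2) F_nz north]) (auto simp: R_eq)
  have "of_int (Brouwer_degree2 2 R) = winding_number (\<lambda>t. ?F (of_real r * cis (2 * pi * t))) 0"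
    unfolding degR
  proof (rule Brouwer_degree2_pair_map)
    show "?F z \<noteq> 0 \<or> complex_of_real (c z) * ?G z \<noteq> 0" for z
      using F_nz [of z] nz [of z] c(3) [of z] by (cases "norm z < r") auto
  qed (use c r in \<open>auto intro!: continuous_intros continuous_on_zzeval\<close>)
  also have "\<dots> = winding_number (\<lambda>t. T (of_real r * cis (2 * pi * t))) 0"
  \<comment> \<open>On the circle of radius \<open>r\<close> the distance from f to T is smaller
    than the distance from T to 0.\<close>
  proof (rule winding_number_nearby_loops_eq)
    fix t :: real
    let ?z = "of_real r * cis (2 * pi * t)"
    have z: "norm ?z = r" using r by (simp add: norm_mult)
    have "m / 2 * r ^ d < m * r ^ d" using m r by simp
    moreover have "?z \<noteq> 0" using z r by auto
    ultimately show "norm (?F ?z - T ?z) < norm (T ?z - 0)"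
      using near [of ?z] T_lower [of ?z] z by simp
  qed (intro path_circle_comp continuous_on_zzeval contT)+
  \<comment> \<open>By homogeneity, changing the radius only multiplies the curve by the constant
    r^d.\<close>
  also have "\<dots> = winding_number (\<lambda>t. T (cis (2 * pi * t))) 0"
    unfolding T_scale
  proof (rule winding_number_cmult)
    show "path (\<lambda>t. T (cis (2 * pi * t)))"
      using path_circle_comp(1) [OF contT, of 1] by simp
  qed (use T_nz r in \<open>auto simp: path_image_def\<close>)
  finally have deg: "of_int (Brouwer_degree2 2 R) = winding_number (\<lambda>t. T (cis (2 * pi * t))) 0" .
  have P_eq: "poly P u = u ^ d * T u" if "norm u = 1" for u
    unfolding P_def T_def by (rule poly_zztilde [OF that])
  have "of_nat N = winding_number (\<lambda>t. poly P (cis (2 * pi * t))) 0"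
    unfolding N_def
  proof (rule winding_number_poly_circle [symmetric])
    show "P \<noteq> 0" unfolding P_def by (rule zztilde_nonzero [OF assms(1) ab])
    show "poly P u \<noteq> 0" if "norm u = 1" for u
      using that T_nz [OF that] by (auto simp: P_eq)
  qed
  \<comment> \<open>The factor u^d by which \<open>P\<close> differs from \<open>T\<close> on the
    circle winds d times; this is the d subtracted from N.\<close>
  also have "\<dots> = winding_number (\<lambda>t. cis (2 * pi * t) ^ d * T (cis (2 * pi * t))) 0"
    by (simp add: P_eq)
  also have "\<dots> = winding_number (\<lambda>t. cis (2 * pi * t) ^ d) 0 + winding_number (\<lambda>t. T (cis (2 * pi * t))) 0"
    using path_circle_comp(1) [OF contT, of 1] T_nz
    by (intro winding_number_mult) (auto simp: path_def path_image_def intro!: continuous_intros)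
  also have "winding_number (\<lambda>t. cis (2 * pi * t) ^ d) 0 = of_nat d"
    using winding_number_shifted_circle [of 1 0]
    by (subst winding_number_power) (auto simp: path_def path_image_def intro!: continuous_intros)
  finally have "complex_of_int (int N) = of_int (int d + Brouwer_degree2 2 R)"
    by (simp add: deg)
  then have "Brouwer_degree2 2 R = int N - int d"
    unfolding of_int_eq_iff by simp
  with deg show ?thesis
    unfolding R_def N_def P_def T_def d_def by simp
qed

end
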